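(* Let $\Omega\subset\mathbb{C}^n$ be a bounded domain. If $\Omega$ can be exhausted by a homogenous regular domain $D\subset\mathbb{C}^n$, then $\Omega$ is homogenous regular.
   Context: For domains $D,\Omega\subset\mathbb{C}^n$, we say that $\Omega$ can be exhausted by $D$ if for every compact subset $K\subset\Omega$ there exists an injective holomorphic map $f:D\to\Omega$ such that $K\subset f(D)$. Squeezing function: let $B^n$ be the open unit ball in $\mathbb{C}^n$ and $B^n(0,r)$ the open Euclidean ball with center $0$ and radius $r$. For a bounded domain $D\subset\mathbb{C}^n$, a point $z\in D$, and an injective holomorphic map $f:D\to B^n$ with $f(z)=0$, put $s_D(z,f)=\sup\{r>0 : B^n(0,r)\subset f(D)\}$. The squeezing function of $D$ is $s_D(z)=\sup_f s_D(z,f)$, where the supremum is over all injective holomorphic maps $f:D\to B^n$ with $f(z)=0$. A bounded domain $D$ is called homogenous regular if $s_D$ has a positive lower bound on $D$, i.e. there is $c>0$ with $s_D(z)\ge c$ for all $z\in D$. *)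

theory Defs
  imports "HOL-Analysis.Analysis"
begin

definition is_domain :: "'a::topological_space set \<Rightarrow> bool" where
  "is_domain D \<longleftrightarrow> open D \<and> connected D \<and> D \<noteq> {}"

(* The library's has_derivative is Frechet differentiability over the reals; holomorphy
   adds that the derivative is linear over the complex numbers. The norm on complex^'n
   is the Euclidean one. *)
definition holomorphic_map_on :: "(complex^'n \<Rightarrow> complex^'m) \<Rightarrow> (complex^'n) set \<Rightarrow> bool" where
  "holomorphic_map_on f D \<longleftrightarrow>
     (\<forall>z\<in>D. \<exists>f'. (f has_derivative f') (at z within D) \<and> Vector_Spaces.linear (*s) (*s) f')"

definition inj_holomorphic_map ::
    "(complex^'n \<Rightarrow> complex^'m) \<Rightarrow> (complex^'n) set \<Rightarrow> (complex^'m) set \<Rightarrow> bool" where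
  "inj_holomorphic_map f D E \<longleftrightarrow> holomorphic_map_on f D \<and> inj_on f D \<and> f ` D \<subseteq> E"

definition exhausted_by :: "(complex^'n) set \<Rightarrow> (complex^'n) set \<Rightarrow> bool" where
  "exhausted_by \<Omega> D \<longleftrightarrow>
     (\<forall>K. compact K \<and> K \<subseteq> \<Omega> \<longrightarrow> (\<exists>f. inj_holomorphic_map f D \<Omega> \<and> K \<subseteq> f ` D))"

(* This is s_D(z,f); the point z enters only through the normalisation f z = 0,
   which is imposed in squeezing_function. *)
definition squeezing_radius :: "(complex^'n) set \<Rightarrow> (complex^'n \<Rightarrow> complex^'n) \<Rightarrow> real" where
  "squeezing_radius D f = Sup {r. r > 0 \<and> ball 0 r \<subseteq> f ` D}"

(* Sup on the reals is unspecified on empty or unbounded sets. For a bounded domain D and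
   z in D neither case occurs, here or in squeezing_radius: f ` D is an open neighbourhood
   of 0 inside the unit ball, so the radii form a nonempty set bounded by 1, and a
   translation followed by a scaling is an admissible f. *)
definition squeezing_function :: "(complex^'n) set \<Rightarrow> complex^'n \<Rightarrow> real" where
  "squeezing_function D z =
     Sup {squeezing_radius D f | f. inj_holomorphic_map f D (ball 0 1) \<and> f z = 0}"

definition homogenous_regular :: "(complex^'n) set \<Rightarrow> bool" where
  "homogenous_regular D \<longleftrightarrow>
     is_domain D \<and> bounded D \<and> (\<exists>c>0. \<forall>z\<in>D. c \<le> squeezing_function D z)"

end

theory Submission
  imports Defs "HOL-Complex_Analysis.Complex_Analysis"
begin

no_notation fps_nth (infixl "$" 75)

text \<open>Fix \<open>z \<in> \<Omega>\<close>. Composing the maps of \<open>D\<close> into \<open>\<Omega>\<close>, which exhaust \<open>\<Omega>\<close>, with maps of \<open>D\<close> into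
  the unit ball whose images contain \<open>ball 0 \<rho>\<close>, one gets mutually inverse holomorphic maps \<open>G n\<close>
  from large parts of \<open>\<Omega>\<close> into the unit ball and \<open>H n\<close> from \<open>ball 0 \<rho>\<close> into \<open>\<Omega>\<close>, with \<open>G n z = 0\<close>.
  By Montel's theorem they converge to \<open>g\<close> and \<open>h\<close> along a subsequence. As \<open>h \<circ> g = id\<close> near \<open>z\<close>,
  Hurwitz's theorem on complex lines shows that both Jacobian determinants vanish nowhere. Since the
  values of limits are then attained by the approximating maps, \<open>g\<close> is injective and \<open>h\<close> maps into
  \<open>\<Omega>\<close>, so the image of \<open>g\<close> contains \<open>ball 0 \<rho>\<close>.

  That injective holomorphic maps have holomorphic inverses (Osgood's theorem) is proved without
  analytic sets, see \<open>det_cjac_nonzero_if_inj\<close>.\<close>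

section \<open>Holomorphic maps on complex lines\<close>

text \<open>Each \<open>G n\<close> lives on its own domain, which contains a given compact subset
  of \<Omega> only from some index on; hence statements about families are required eventually and
  on small balls. Normality has two sources: the \<open>G n\<close> take values in the unit ball,
  the \<open>H n\<close> in the bounded set \<Omega>. The obstacle is that limits only land in
  closures: a priori \<open>h\<close> may reach the frontier of \<Omega>, and \<open>g\<close> may
  degenerate. The normalisation \<open>G n z = 0\<close> excludes degeneracy at one point, because
  \<open>g z = 0\<close> lies in the domain of \<open>h\<close>, so that the chain rule gives
  \<open>det (cjac h 0) * det (cjac g z) = 1\<close>; Hurwitz's theorem spreads this to all points.
  Function theory of several variables is largely replaced by one-variable theorems on complex
  lines, together with Taylor bounds whose constants depend only on a radius and a bound for the
  map. Osgood's theorem is used twice: for the holomorphy of the inverses that occur in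
  \<open>G n\<close> and \<open>H n\<close>, and for the nonvanishing of the approximating
  determinants.\<close>

lemma norm_vector_smult: "norm (c *s x) = cmod c * norm x" for x :: "complex^'n"
  by (simp add: norm_vec_def norm_mult L2_set_right_distrib)

lemma norm_le_sum_components: "norm x \<le> (\<Sum>i\<in>UNIV. norm (x $ i))" for x :: "complex^'n"
  by (simp add: norm_vec_def L2_set_le_sum)

lemma norm_le_card_bound:
  fixes x :: "complex^'n" and B :: real
  assumes "\<And>i. cmod (x $ i) \<le> B"
  shows "norm x \<le> CARD('n) * B"
  using norm_le_sum_components[of x] sum_bounded_above[of UNIV "\<lambda>i. cmod (x $ i)" B] assms
  by fastforce

lemma of_real_smult_eq_scaleR: "complex_of_real r *s x = r *\<^sub>R x" for x :: "complex^'n"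
  unfolding vec_eq_iff vector_smult_component vector_scaleR_component
  by (simp add: scaleR_conv_of_real)

lemma bounded_linear_smult_left: "bounded_linear (\<lambda>\<zeta>. \<zeta> *s v)" for v :: "complex^'n"
  by (rule bounded_linear_intro[where K = "norm v"])
     (auto simp: vec_eq_iff algebra_simps norm_vector_smult)

lemma bounded_linear_matrix_vector_mult: "bounded_linear ((*v) A)" for A :: "complex^'n^'m"
  by (simp add: linear_conv_bounded_linear[symmetric] linear_matrix_vector_mul_eq)

text \<open>\<open>matrix\<close> reads off only the values on the complex unit vectors, so the real
  Frechet derivative is recovered from this matrix exactly when it is complex linear.\<close>

definition cjac :: "(complex^'n \<Rightarrow> complex^'m) \<Rightarrow> complex^'n \<Rightarrow> complex^'n^'m" where
  "cjac f x = matrix (frechet_derivative f (at x))"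

lemma cjac_eqI:
  assumes "(f has_derivative (*v) A) (at x)"
  shows "cjac f x = A"
  using frechet_derivative_at[OF assms] unfolding cjac_def
  by (metis matrix_of_matrix_vector_mul)

lemma holomorphic_map_onI:
  assumes "\<And>x. x \<in> S \<Longrightarrow> (f has_derivative (*v) (A x)) (at x)"
  shows "holomorphic_map_on f S"
  unfolding holomorphic_map_on_def
  using assms has_derivative_at_withinI matrix_vector_mul_linear_gen by blast

lemma holomorphic_map_on_subset:
  "holomorphic_map_on f S \<Longrightarrow> T \<subseteq> S \<Longrightarrow> holomorphic_map_on f T"
  unfolding holomorphic_map_on_def by (meson has_derivative_subset subsetD)

lemma has_derivative_cjac:
  assumes "holomorphic_map_on f S" "open S" "x \<in> S"
  shows "(f has_derivative (*v) (cjac f x)) (at x)"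
proof -
  obtain f' where f': "(f has_derivative f') (at x)" "Vector_Spaces.linear (*s) (*s) f'"
    using assms unfolding holomorphic_map_on_def by (metis at_within_open)
  then have "f' = (*v) (matrix f')"
    by (simp add: fun_eq_iff matrix_works)
  then show ?thesis
    using f' cjac_eqI by metis
qed

lemma holomorphic_map_on_imp_continuous_on:
  "holomorphic_map_on f S \<Longrightarrow> continuous_on S f"
  unfolding holomorphic_map_on_def
  by (meson continuous_on_eq_continuous_within has_derivative_continuous)

lemma holomorphic_map_on_compose:
  assumes f: "holomorphic_map_on f S" and g: "holomorphic_map_on g T"
    and "open S" "open T" "f ` S \<subseteq> T"
  shows "holomorphic_map_on (g \<circ> f) S"
    and "x \<in> S \<Longrightarrow> cjac (g \<circ> f) x = cjac g (f x) ** cjac f x"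
proof -
  have *: "(g \<circ> f has_derivative (*v) (cjac g (f x) ** cjac f x)) (at x)" if "x \<in> S" for x
  proof -
    have "(g \<circ> f has_derivative ((*v) (cjac g (f x)) \<circ> (*v) (cjac f x))) (at x)"
      by (intro diff_chain_at has_derivative_cjac[OF f] has_derivative_cjac[OF g])
         (use assms that in auto)
    then show ?thesis
      by (simp add: o_def matrix_vector_mul_assoc)
  qed
  show "holomorphic_map_on (g \<circ> f) S"
    using * by (rule holomorphic_map_onI)
  show "x \<in> S \<Longrightarrow> cjac (g \<circ> f) x = cjac g (f x) ** cjac f x"
    using * by (blast intro: cjac_eqI)
qed

text \<open>Restriction to a complex line turns each component into a holomorphic function of one
  variable. Cauchy's estimates and Hurwitz's theorem enter through such restrictions.\<close>

lemma has_field_derivative_along_line: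
  assumes f: "holomorphic_map_on f S" "open S" "x + \<zeta> *s v \<in> S"
  shows "((\<lambda>\<zeta>. f (x + \<zeta> *s v) $ i) has_field_derivative (cjac f (x + \<zeta> *s v) *v v) $ i) (at \<zeta>)"
proof -
  have "((\<lambda>\<zeta>. x + \<zeta> *s v) has_derivative (\<lambda>\<zeta>. \<zeta> *s v)) (at \<zeta>)"
    by (auto intro!: derivative_eq_intros bounded_linear_imp_has_derivative bounded_linear_smult_left)
  then have "(f \<circ> (\<lambda>\<zeta>. x + \<zeta> *s v) has_derivative (*v) (cjac f (x + \<zeta> *s v)) \<circ> (\<lambda>\<zeta>. \<zeta> *s v)) (at \<zeta>)"
    by (intro diff_chain_at has_derivative_cjac[OF f])
  then have "((\<lambda>\<zeta>. f (x + \<zeta> *s v)) has_derivative (\<lambda>h. cjac f (x + \<zeta> *s v) *v (h *s v))) (at \<zeta>)"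
    by (simp add: o_def)
  from bounded_linear.has_derivative[OF bounded_linear_vec_nth this, of i] show ?thesis
    unfolding has_field_derivative_def vec.scale vector_smult_component
    by (rule has_derivative_eq_rhs) (simp add: fun_eq_iff)
qed

lemma holomorphic_on_line:
  assumes "holomorphic_map_on f S" "open S" "\<And>\<zeta>. \<zeta> \<in> U \<Longrightarrow> x + \<zeta> *s v \<in> S"
  shows "(\<lambda>\<zeta>. f (x + \<zeta> *s v) $ i) holomorphic_on U"
  using has_field_derivative_along_line[OF assms(1,2)] assms(3)
  by (meson field_differentiable_at_within field_differentiable_def holomorphic_on_def)

section \<open>Cauchy estimates and Taylor bounds\<close>

text \<open>Since \<open>\<rho> > 2\<close>, a disc of radius \<open>\<rho> / 2\<close> about any
  point of the closed unit disc stays in \<open>ball 0 \<rho>\<close>. Cauchy's inequality there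
  bounds the first two derivatives by \<open>2 * M / \<rho>\<close> and
  \<open>8 * M / \<rho>^2\<close>, and these bounds pass to the Taylor remainders at 1.\<close>

lemma cauchy_taylor_bounds:
  assumes hol: "F holomorphic_on ball 0 \<rho>" and \<rho>: "\<rho> > 2"
    and M: "\<And>\<zeta>. \<zeta> \<in> ball 0 \<rho> \<Longrightarrow> cmod (F \<zeta>) \<le> M"
  shows "cmod (F 1 - F 0) \<le> 2 * M / \<rho>"
    and "cmod (F 1 - F 0 - deriv F 0) \<le> 8 * M / \<rho>^2"
proof -
  have bd: "cmod ((deriv ^^ n) F \<zeta>) \<le> fact n * M / (\<rho> / 2) ^ n" if "\<zeta> \<in> cball 0 1" for n \<zeta>
  proof (rule Cauchy_inequality)
    have sub: "cball \<zeta> (\<rho> / 2) \<subseteq> ball 0 \<rho>"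
      using that \<rho> by (intro cball_subset_ball_iff[THEN iffD2]) (simp add: dist_norm)
    show "F holomorphic_on ball \<zeta> (\<rho> / 2)"
      using hol sub by (meson ball_subset_cball holomorphic_on_subset)
    show "continuous_on (cball \<zeta> (\<rho> / 2)) F"
      using hol sub by (meson continuous_on_subset holomorphic_on_imp_continuous_on)
    show "cmod (F x) \<le> M" if "cmod (\<zeta> - x) = \<rho> / 2" for x
      using M sub that by (auto simp: dist_norm subset_iff)
  qed (use \<rho> in auto)
  have der: "((deriv ^^ i) F has_field_derivative (deriv ^^ Suc i) F x) (at x within cball 0 1)"
    if "x \<in> cball 0 1" for i x
  proof -
    have "(deriv ^^ i) F holomorphic_on ball 0 \<rho>"
      using hol by (simp add: holomorphic_higher_deriv)
    then have "((deriv ^^ i) F has_field_derivative (deriv ^^ Suc i) F x) (at x)"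
      using that \<rho> holomorphic_derivI[of "(deriv ^^ i) F" "ball 0 \<rho>" x UNIV] by simp
    then show ?thesis
      by (rule DERIV_subset) auto
  qed
  have "cmod ((deriv ^^ 0) F 1 - (\<Sum>i\<le>0. (deriv ^^ i) F 0 * (1 - 0) ^ i / fact i))
      \<le> 2 * M / \<rho> * cmod (1 - 0) ^ Suc 0 / fact 0"
  proof (rule complex_Taylor)
    show "cmod ((deriv ^^ Suc 0) F x) \<le> 2 * M / \<rho>" if "x \<in> cball 0 1" for x
      using bd[OF that, of 1] by (simp add: mult.commute)
    show "((deriv ^^ i) F has_field_derivative (deriv ^^ Suc i) F x) (at x within cball 0 1)"
      if "x \<in> cball 0 1" for i x
      using der[OF that] .
  qed auto
  then show "cmod (F 1 - F 0) \<le> 2 * M / \<rho>"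
    by simp
  have "cmod ((deriv ^^ 0) F 1 - (\<Sum>i\<le>1. (deriv ^^ i) F 0 * (1 - 0) ^ i / fact i))
      \<le> 8 * M / \<rho>^2 * cmod (1 - 0) ^ Suc 1 / fact 1"
  proof (rule complex_Taylor)
    show "cmod ((deriv ^^ Suc 1) F x) \<le> 8 * M / \<rho>^2" if "x \<in> cball 0 1" for x
      using bd[OF that, of 2] by (simp add: power_divide numeral_2_eq_2)
    show "((deriv ^^ i) F has_field_derivative (deriv ^^ Suc i) F x) (at x within cball 0 1)"
      if "x \<in> cball 0 1" for i x
      using der[OF that] .
  qed auto
  then show "cmod (F 1 - F 0 - deriv F 0) \<le> 8 * M / \<rho>^2"
    by (simp add: algebra_simps)
qed

text \<open>The one-variable bounds are applied along the line from \<open>x\<close> to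
  \<open>y\<close>, parametrised so that \<open>y\<close> sits at 1; the disc then has radius
  \<open>R / norm (y - x)\<close>, which exceeds 2. \<open>CARD('m)\<close> pays for the passage
  from components to the norm. The constants depend on \<open>R\<close> and \<open>M\<close> only,
  so they serve whole families of maps.\<close>

lemma cauchy_vector_bounds:
  fixes f :: "complex^'n \<Rightarrow> complex^'m"
  assumes hol: "holomorphic_map_on f (ball x R)"
    and M: "\<And>y. y \<in> ball x R \<Longrightarrow> norm (f y) \<le> M"
    and y: "norm (y - x) < R / 2"
  shows "norm (f y - f x) \<le> CARD('m) * (2 * M / R) * norm (y - x)"
    and "norm (f y - f x - cjac f x *v (y - x)) \<le> CARD('m) * (8 * M / R^2) * norm (y - x)^2"
proof -
  have "R > 0"
    using y norm_ge_zero[of "y - x"] by linarith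
  define d where "d = norm (y - x)"
  have *: "cmod ((f y - f x) $ i) \<le> (2 * M / R) * d \<and>
      cmod ((f y - f x - cjac f x *v (y - x)) $ i) \<le> (8 * M / R^2) * d^2" for i
  proof (cases "y = x")
    case True
    then show ?thesis by (simp add: d_def)
  next
    case False
    then have "d > 0" by (simp add: d_def)
    define \<rho> where "\<rho> = R / d"
    have \<rho>: "\<rho> > 2"
      using y \<open>d > 0\<close> unfolding \<rho>_def d_def by (simp add: field_simps)
    define F where "F = (\<lambda>\<zeta>. f (x + \<zeta> *s (y - x)) $ i)"
    have mem: "x + \<zeta> *s (y - x) \<in> ball x R" if "\<zeta> \<in> ball 0 \<rho>" for \<zeta>
      using that \<open>d > 0\<close>
      by (simp add: dist_norm norm_vector_smult \<rho>_def d_def[symmetric] pos_less_divide_eq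
          del: vector_ssub_ldistrib)
    have "F holomorphic_on ball 0 \<rho>"
      unfolding F_def by (rule holomorphic_on_line[OF hol]) (use mem in auto)
    moreover have "cmod (F \<zeta>) \<le> M" if "\<zeta> \<in> ball 0 \<rho>" for \<zeta>
      using M[OF mem[OF that]]
      unfolding F_def by (meson Finite_Cartesian_Product.norm_nth_le order_trans)
    moreover have "deriv F 0 = (cjac f x *v (y - x)) $ i"
      using has_field_derivative_along_line[OF hol, of x 0 "y - x" i] \<open>R > 0\<close>
      unfolding F_def by (simp add: DERIV_imp_deriv)
    moreover have "F 1 = f y $ i" "F 0 = f x $ i"
      by (simp_all add: F_def)
    ultimately show ?thesis
      using cauchy_taylor_bounds[of F \<rho> M] \<rho> by (simp add: \<rho>_def power_divide)
  qed
  show "norm (f y - f x) \<le> CARD('m) * (2 * M / R) * norm (y - x)"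
    using norm_le_card_bound[of "f y - f x" "(2 * M / R) * d"] * by (simp add: d_def algebra_simps)
  show "norm (f y - f x - cjac f x *v (y - x)) \<le> CARD('m) * (8 * M / R^2) * norm (y - x)^2"
    using norm_le_card_bound[of "f y - f x - cjac f x *v (y - x)" "(8 * M / R^2) * d^2"] *
    by (simp add: d_def algebra_simps)
qed

section \<open>Limits of holomorphic maps\<close>

lemma cjac_entry: "cjac f x $ i $ j = (cjac f x *v axis j 1) $ i"
  by (simp add: matrix_vector_mult_def axis_def if_distrib cong: if_cong)

text \<open>The quadratic Taylor bound has the same constant for all large \<open>j\<close> and
  therefore survives in the limit, where it amounts to differentiability of \<open>g\<close>. The
  derivatives converge because difference quotients with a fixed step do, and these are uniformly
  close to them.\<close>

lemma holomorphic_limit_at: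
  fixes f :: "nat \<Rightarrow> complex^'n \<Rightarrow> complex^'m"
  assumes "R > 0"
    and hol: "\<forall>\<^sub>F j in sequentially. holomorphic_map_on (f j) (ball x R) \<and> (\<forall>y\<in>ball x R. norm (f j y) \<le> M)"
    and lim: "\<And>y. y \<in> ball x R \<Longrightarrow> (\<lambda>j. f j y) \<longlonglongrightarrow> g y"
  obtains A where "(\<lambda>j. cjac (f j) x) \<longlonglongrightarrow> A" "(g has_derivative (*v) A) (at x)"
proof -
  define C where "C = CARD('m) * (8 * M / R^2)"
  have rem: "\<forall>\<^sub>F j in sequentially. norm (f j (x + v) - f j x - cjac (f j) x *v v) \<le> C * norm v ^ 2"
    if "norm v < R / 2" for v
    using hol
  proof eventually_elim
    case (elim j)
    then show ?case
      using cauchy_vector_bounds(2)[of "f j" x R M "x + v"] that by (simp add: C_def)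
  qed
  have C: "C \<ge> 0"
  proof -
    obtain j where "\<forall>y\<in>ball x R. norm (f j y) \<le> M"
      using eventually_happens[OF hol] by auto
    then have "norm (f j x) \<le> M"
      using \<open>R > 0\<close> by auto
    then have "M \<ge> 0"
      using norm_ge_zero order_trans by blast
    then show ?thesis
      by (simp add: C_def)
  qed
  have cvg: "convergent (\<lambda>j. cjac (f j) x *v v)" for v
  proof (rule Cauchy_convergent, rule CauchyI)
    fix e :: real assume "e > 0"
    \<comment> \<open>The step \<open>t\<close> is chosen so short that the difference quotient is
      within \<open>e / 3\<close> of the derivative along \<open>v\<close> for all large
      \<open>j\<close> at once.\<close>
    have "((\<lambda>t. t * norm v) \<longlongrightarrow> 0 * norm v) (at_right 0)" "((\<lambda>t. C * t * norm v ^ 2) \<longlongrightarrow> C * 0 * norm v ^ 2) (at_right 0)"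
      by (intro tendsto_intros)+
    then have "\<forall>\<^sub>F t in at_right 0. t * norm v < R / 2" "\<forall>\<^sub>F t in at_right 0. C * t * norm v ^ 2 < e / 3"
      using order_tendstoD(2)[of "\<lambda>t. t * norm v" _ "at_right 0" "R / 2"]
        order_tendstoD(2)[of "\<lambda>t. C * t * norm v ^ 2" _ "at_right 0" "e / 3"] \<open>R > 0\<close> \<open>e > 0\<close>
      by simp_all
    moreover have "\<forall>\<^sub>F t in at_right 0. (0::real) < t"
      by (simp add: eventually_at_right_less)
    ultimately have "\<forall>\<^sub>F t in at_right 0. t * norm v < R / 2 \<and> C * t * norm v ^ 2 < e / 3 \<and> 0 < t"
      by eventually_elim auto
    then obtain t where t: "t * norm v < R / 2" "C * t * norm v ^ 2 < e / 3" "0 < t"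
      using eventually_happens trivial_limit_at_right_real by blast
    have tv: "norm (t *\<^sub>R v) < R / 2"
      using t by simp
    define q where "q = (\<lambda>j. (f j (x + t *\<^sub>R v) - f j x) /\<^sub>R t)"
    have "x + t *\<^sub>R v \<in> ball x R" "x \<in> ball x R"
      using tv \<open>R > 0\<close> by (auto simp: dist_norm)
    then have "q \<longlonglongrightarrow> (g (x + t *\<^sub>R v) - g x) /\<^sub>R t"
      unfolding q_def by (intro tendsto_intros lim)
    then have "Cauchy q"
      by (rule LIMSEQ_imp_Cauchy)
    then obtain N where N: "\<And>m n. m \<ge> N \<Longrightarrow> n \<ge> N \<Longrightarrow> norm (q m - q n) < e / 3"
      using CauchyD[of q "e / 3"] \<open>e > 0\<close> by auto
    obtain N' where N': "\<And>j. j \<ge> N' \<Longrightarrow>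
        norm (f j (x + t *\<^sub>R v) - f j x - cjac (f j) x *v (t *\<^sub>R v)) \<le> C * norm (t *\<^sub>R v) ^ 2"
      using rem[OF tv] unfolding eventually_sequentially by blast
    have close: "norm (q j - cjac (f j) x *v v) < e / 3" if "j \<ge> N'" for j
    proof -
      have lin: "cjac (f j) x *v (t *\<^sub>R v) = t *\<^sub>R (cjac (f j) x *v v)"
        by (metis of_real_smult_eq_scaleR vec.scale)
      have "q j - cjac (f j) x *v v = (f j (x + t *\<^sub>R v) - f j x - cjac (f j) x *v (t *\<^sub>R v)) /\<^sub>R t"
        using t(3) by (simp add: q_def lin algebra_simps)
      then have "norm (q j - cjac (f j) x *v v)
          = norm (f j (x + t *\<^sub>R v) - f j x - cjac (f j) x *v (t *\<^sub>R v)) / t"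
        using t(3) by (simp add: divide_inverse mult.commute)
      also have "\<dots> \<le> C * norm (t *\<^sub>R v) ^ 2 / t"
        using N'[OF that] t(3) by (simp add: divide_right_mono)
      also have "\<dots> = C * t * norm v ^ 2"
        using t(3) by (simp add: power2_eq_square field_simps)
      finally show ?thesis using t(2) by linarith
    qed
    have "norm (cjac (f m) x *v v - cjac (f n) x *v v) < e" if "m \<ge> max N N'" "n \<ge> max N N'" for m n
    proof -
      have "cjac (f m) x *v v - cjac (f n) x *v v
          = (q m - q n) - (q m - cjac (f m) x *v v) + (q n - cjac (f n) x *v v)"
        by simp
      also have "norm \<dots> \<le> norm (q m - q n) + norm (q m - cjac (f m) x *v v) + norm (q n - cjac (f n) x *v v)"
        by (meson add_mono norm_triangle_ineq norm_triangle_ineq4 order_refl order_trans)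
      also have "\<dots> < e"
        using N[of m n] close[of m] close[of n] that by simp
      finally show ?thesis .
    qed
    then show "\<exists>N. \<forall>m\<ge>N. \<forall>n\<ge>N. norm (cjac (f m) x *v v - cjac (f n) x *v v) < e"
      by blast
  qed
  define A where "A = (\<chi> i k. lim (\<lambda>j. cjac (f j) x *v axis k 1) $ i)"
  have entry: "(\<lambda>j. cjac (f j) x $ i $ k) \<longlonglongrightarrow> A $ i $ k" for i k
    using tendsto_vec_nth[OF cvg[of "axis k 1", unfolded convergent_LIMSEQ_iff], of i]
    by (simp add: A_def cjac_entry)
  have A: "(\<lambda>j. cjac (f j) x) \<longlonglongrightarrow> A"
    by (intro vec_tendstoI entry)
  have Av: "(\<lambda>j. cjac (f j) x *v v) \<longlonglongrightarrow> A *v v" for v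
    unfolding matrix_vector_mult_def
    by (rule vec_tendstoI) (auto intro!: tendsto_intros entry)
  have remg: "norm (g (x + v) - g x - A *v v) \<le> C * norm v ^ 2" if v: "norm v < R / 2" for v
  proof (rule tendsto_upperbound[OF _ rem[OF v]])
    have "x + v \<in> ball x R" "x \<in> ball x R"
      using v \<open>R > 0\<close> norm_ge_zero[of v] by (auto simp: dist_norm simp del: norm_ge_zero)
    then show "(\<lambda>j. norm (f j (x + v) - f j x - cjac (f j) x *v v)) \<longlonglongrightarrow> norm (g (x + v) - g x - A *v v)"
      by (intro tendsto_intros lim Av)
  qed auto
  have "(g has_derivative (*v) A) (at x)"
    unfolding has_derivative_at_alt
  proof (intro conjI allI impI)
    show "bounded_linear ((*v) A)" by (rule bounded_linear_matrix_vector_mult)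
    fix e :: real assume "e > 0"
    define d where "d = min (R / 2) (e / (C + 1))"
    have "d > 0" using \<open>e > 0\<close> \<open>R > 0\<close> C by (simp add: d_def)
    moreover have "norm (g y - g x - A *v (y - x)) \<le> e * norm (y - x)" if "norm (y - x) < d" for y
    proof -
      have "C * norm (y - x) \<le> (C + 1) * (e / (C + 1))"
        using that C by (intro mult_mono) (auto simp: d_def)
      then have "C * norm (y - x) * norm (y - x) \<le> e * norm (y - x)"
        using C by (intro mult_right_mono) auto
      moreover have "norm (g y - g x - A *v (y - x)) \<le> C * norm (y - x) ^ 2"
        using remg[of "y - x"] that by (simp add: d_def)
      ultimately show ?thesis by (simp add: power2_eq_square)
    qed
    ultimately show "\<exists>d>0. \<forall>y. norm (y - x) < d \<longrightarrow> norm (g y - g x - A *v (y - x)) \<le> e * norm (y - x)"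
      by blast
  qed
  with A that show ?thesis by blast
qed

text \<open>The maps of interest are holomorphic near a given point only from some index on, whence
  the eventuality; radius and bound may depend on the point but not on the index.\<close>

definition loc_bounded_holomorphic :: "(nat \<Rightarrow> complex^'n \<Rightarrow> complex^'m) \<Rightarrow> (complex^'n) set \<Rightarrow> bool" where
  "loc_bounded_holomorphic f S \<longleftrightarrow> (\<forall>x\<in>S. \<exists>R>0. \<exists>M. \<forall>\<^sub>F j in sequentially.
      holomorphic_map_on (f j) (ball x R) \<and> (\<forall>y\<in>ball x R. norm (f j y) \<le> M))"

lemma holomorphic_limit:
  fixes f :: "nat \<Rightarrow> complex^'n \<Rightarrow> complex^'m"
  assumes loc: "loc_bounded_holomorphic f S"
    and "open S"
    and lim: "\<And>y. y \<in> S \<Longrightarrow> (\<lambda>j. f j y) \<longlonglongrightarrow> g y"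
  shows "holomorphic_map_on g S"
    and "x \<in> S \<Longrightarrow> (\<lambda>j. cjac (f j) x) \<longlonglongrightarrow> cjac g x"
proof -
  have *: "\<exists>A. (\<lambda>j. cjac (f j) x) \<longlonglongrightarrow> A \<and> (g has_derivative (*v) A) (at x)" if "x \<in> S" for x
  proof -
    obtain R M where R: "R > 0" "\<forall>\<^sub>F j in sequentially.
        holomorphic_map_on (f j) (ball x R) \<and> (\<forall>y\<in>ball x R. norm (f j y) \<le> M)"
      using loc \<open>x \<in> S\<close> unfolding loc_bounded_holomorphic_def by blast
    obtain R' where R': "R' > 0" "ball x R' \<subseteq> S"
      using \<open>open S\<close> \<open>x \<in> S\<close> open_contains_ball by blast
    define r where "r = min R R'"
    have r: "r > 0" "ball x r \<subseteq> ball x R" "ball x r \<subseteq> S"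
      using R(1) R' by (auto simp: r_def)
    show ?thesis
    proof (rule holomorphic_limit_at[OF r(1), of f x M g])
      show "\<forall>\<^sub>F j in sequentially. holomorphic_map_on (f j) (ball x r) \<and> (\<forall>y\<in>ball x r. norm (f j y) \<le> M)"
        using R(2) by eventually_elim (use r(2) holomorphic_map_on_subset in blast)
      show "(\<lambda>j. f j y) \<longlonglongrightarrow> g y" if "y \<in> ball x r" for y
        using lim r(3) that by blast
    qed blast
  qed
  then have der: "(g has_derivative (*v) (cjac g x)) (at x)" if "x \<in> S" for x
    using that cjac_eqI by metis
  show "holomorphic_map_on g S"
    using der by (rule holomorphic_map_onI)
  show "x \<in> S \<Longrightarrow> (\<lambda>j. cjac (f j) x) \<longlonglongrightarrow> cjac g x"
    using * cjac_eqI by metis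
qed

section \<open>Holomorphy of derivatives and of the Jacobian determinant\<close>

lemma mat_vector_mult: "mat c *v x = c *s x" for c :: complex
  by (simp add: vec_eq_iff matrix_vector_mult_def mat_def if_distrib[where f = "\<lambda>a. a * _"] cong: if_cong)

lemma holomorphic_map_on_difference_quotient:
  fixes f :: "complex^'n \<Rightarrow> complex^'m"
  assumes f: "holomorphic_map_on f S" and "open S" and T: "\<And>y. y \<in> T \<Longrightarrow> y \<in> S \<and> y + u \<in> S"
  shows "holomorphic_map_on (\<lambda>y. c *s (f (y + u) - f y)) T"
proof (rule holomorphic_map_onI)
  fix y assume "y \<in> T"
  have "((\<lambda>y. y + u) has_derivative (\<lambda>h. h)) (at y)"
    by (auto intro!: derivative_eq_intros)
  then have "(f \<circ> (\<lambda>y. y + u) has_derivative (*v) (cjac f (y + u)) \<circ> (\<lambda>h. h)) (at y)"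
    using T[OF \<open>y \<in> T\<close>] by (intro diff_chain_at has_derivative_cjac[OF f \<open>open S\<close>]) auto
  then have "((\<lambda>y. f (y + u) - f y) has_derivative (\<lambda>h. cjac f (y + u) *v h - cjac f y *v h)) (at y)"
    using has_derivative_cjac[OF f \<open>open S\<close>] T[OF \<open>y \<in> T\<close>]
    by (intro has_derivative_diff) (auto simp: o_def)
  from bounded_linear.has_derivative[OF bounded_linear_matrix_vector_mult this, of "mat c"]
  have "((\<lambda>y. c *s (f (y + u) - f y)) has_derivative (\<lambda>h. mat c *v (cjac f (y + u) *v h - cjac f y *v h))) (at y)"
    by (simp only: mat_vector_mult)
  then show "((\<lambda>y. c *s (f (y + u) - f y)) has_derivative (*v) (mat c ** (cjac f (y + u) - cjac f y))) (at y)"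
    by (rule has_derivative_eq_rhs)
       (rule ext, simp only: matrix_vector_mul_assoc[symmetric] matrix_vector_mult_diff_rdistrib)
qed

text \<open>The derivative along \<open>w\<close> is the limit of difference quotients with steps
  \<open>w / (k + 1)\<close>. Near each point these are eventually holomorphic and, by Cauchy's
  bounds, uniformly bounded, so the theorem on limits of holomorphic maps applies.\<close>

lemma holomorphic_map_on_directional_derivative:
  fixes f :: "complex^'n \<Rightarrow> complex^'m"
  assumes f: "holomorphic_map_on f S" and "open S"
  shows "holomorphic_map_on (\<lambda>x. cjac f x *v w) S"
proof -
  have "holomorphic_map_on (\<lambda>x. cjac f x *v w) (ball x (R / 4))"
    if "R > 0" and R: "cball x R \<subseteq> S" for x R
  proof -
    have "compact (f ` cball x R)"
      using holomorphic_map_on_imp_continuous_on[OF f] R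
      by (intro compact_continuous_image continuous_on_subset[OF _ R]) auto
    then obtain M where M: "\<And>y. y \<in> cball x R \<Longrightarrow> norm (f y) \<le> M"
      by (metis bounded_iff compact_imp_bounded imageI)
    define u :: "nat \<Rightarrow> complex^'n" where "u = (\<lambda>k. inverse (real (Suc k)) *\<^sub>R w)"
    have u0: "u \<longlonglongrightarrow> 0"
      unfolding u_def using LIMSEQ_inverse_real_of_nat tendsto_scaleR[OF _ tendsto_const, of _ 0 _ w] by fastforce
    then have ev: "\<forall>\<^sub>F k in sequentially. norm (u k) < R / 4"
      using order_tendstoD(2)[OF tendsto_norm[OF u0], of "R / 4"] \<open>R > 0\<close> by simp
    define q where "q = (\<lambda>k y. complex_of_real (real (Suc k)) *s (f (y + u k) - f y))"
    define B where "B = CARD('m) * (2 * M / (R / 2))"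
    define B' where "B' = CARD('m) * (8 * M / (R / 2)^2)"
    \<comment> \<open>Points within \<open>R / 4\<close> of \<open>x\<close> keep a ball of radius
      \<open>R / 2\<close> inside \<open>cball x R\<close>; steps shorter than \<open>R / 4\<close>,
      half that radius, are what the Cauchy bounds require.\<close>
    have ball: "ball y (R / 2) \<subseteq> cball x R" if "y \<in> ball x (R / 4)" for y
      using that \<open>R > 0\<close> by (intro ball_subset_cball_iff[THEN iffD2]) (auto simp: dist_commute)
    have hol: "holomorphic_map_on f (ball y (R / 2))" if "y \<in> ball x (R / 4)" for y
      using f ball[OF that] R holomorphic_map_on_subset by blast
    have su: "real (Suc k) * norm (u k) = norm w" for k
      by (simp add: u_def)
    have "holomorphic_map_on (q k) (ball x (R / 4)) \<and> (\<forall>y\<in>ball x (R / 4). norm (q k y) \<le> B * norm w)"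
      if k: "norm (u k) < R / 4" for k
    proof (intro conjI ballI)
      show "holomorphic_map_on (q k) (ball x (R / 4))"
        unfolding q_def
      proof (rule holomorphic_map_on_difference_quotient[OF f \<open>open S\<close>])
        fix y assume y: "y \<in> ball x (R / 4)"
        then have "y \<in> ball y (R / 2)" "y + u k \<in> ball y (R / 2)"
          using k \<open>R > 0\<close> by (auto simp: dist_norm)
        then show "y \<in> S \<and> y + u k \<in> S"
          using ball[OF y] R by blast
      qed
      fix y assume y: "y \<in> ball x (R / 4)"
      have "norm (f (y + u k) - f y) \<le> B * norm (u k)"
        using cauchy_vector_bounds(1)[OF hol[OF y], of M "y + u k"] M ball[OF y] k
        unfolding B_def by (simp add: subset_iff)
      then have "norm (q k y) \<le> real (Suc k) * (B * norm (u k))"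
        unfolding q_def norm_vector_smult norm_of_real abs_of_nat by (intro mult_left_mono) auto
      then show "norm (q k y) \<le> B * norm w"
        by (simp add: su[of k, symmetric] mult.left_commute)
    qed
    then have *: "\<forall>\<^sub>F k in sequentially. holomorphic_map_on (q k) (ball x (R / 4)) \<and> (\<forall>y\<in>ball x (R / 4). norm (q k y) \<le> B * norm w)"
      using ev by (auto elim: eventually_mono)
    have lim: "(\<lambda>k. q k y) \<longlonglongrightarrow> cjac f y *v w" if y: "y \<in> ball x (R / 4)" for y
    proof (rule Lim_transform_bound[THEN LIM_zero_cancel])
      show "\<forall>\<^sub>F k in sequentially. norm (q k y - cjac f y *v w) \<le> norm (B' * norm w * norm (u k))"
        using ev
      proof eventually_elim
        case (elim k)
        have w: "w = complex_of_real (real (Suc k)) *s u k"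
          by (simp only: of_real_smult_eq_scaleR) (simp add: u_def)
        have "norm (f (y + u k) - f y - cjac f y *v u k) \<le> B' * norm (u k) ^ 2"
          using cauchy_vector_bounds(2)[OF hol[OF y], of M "y + u k"] M ball[OF y] elim
          unfolding B'_def by (simp add: subset_iff)
        moreover have "q k y - cjac f y *v w = complex_of_real (real (Suc k)) *s (f (y + u k) - f y - cjac f y *v u k)"
          by (subst w) (simp only: q_def vec.scale vector_ssub_ldistrib)
        then have "norm (q k y - cjac f y *v w) = real (Suc k) * norm (f (y + u k) - f y - cjac f y *v u k)"
          by (simp only: norm_vector_smult norm_of_real abs_of_nat)
        ultimately have "norm (q k y - cjac f y *v w) \<le> real (Suc k) * (B' * norm (u k) ^ 2)"
          by (simp only: mult_left_mono of_nat_0_le_iff)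
        also have "\<dots> = B' * norm w * norm (u k)"
          by (simp add: su[of k, symmetric] power2_eq_square)
        finally show ?case by simp
      qed
      show "(\<lambda>k. B' * norm w * norm (u k)) \<longlonglongrightarrow> 0"
        using tendsto_mult[OF tendsto_const tendsto_norm[OF u0]] by simp
    qed
    show ?thesis
    proof (rule holomorphic_limit(1)[OF _ open_ball lim])
      show "loc_bounded_holomorphic q (ball x (R / 4))"
        unfolding loc_bounded_holomorphic_def
      proof
        fix y assume "y \<in> ball x (R / 4)"
        then obtain r where r: "r > 0" "ball y r \<subseteq> ball x (R / 4)"
          using open_contains_ball by (metis open_ball)
        show "\<exists>r>0. \<exists>M. \<forall>\<^sub>F k in sequentially.
            holomorphic_map_on (q k) (ball y r) \<and> (\<forall>z\<in>ball y r. norm (q k z) \<le> M)"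
        proof (intro exI conjI)
          show "\<forall>\<^sub>F k in sequentially.
              holomorphic_map_on (q k) (ball y r) \<and> (\<forall>z\<in>ball y r. norm (q k z) \<le> B * norm w)"
            using * by eventually_elim (use r holomorphic_map_on_subset in blast)
        qed (rule r)
      qed
    qed
  qed
  note * = this
  have "((\<lambda>x. cjac f x *v w) has_derivative (*v) (cjac (\<lambda>x. cjac f x *v w) x)) (at x)" if "x \<in> S" for x
  proof -
    obtain R where "R > 0" "cball x R \<subseteq> S"
      using \<open>open S\<close> \<open>x \<in> S\<close> open_contains_cball by blast
    with *[OF this] show ?thesis
      by (intro has_derivative_cjac) auto
  qed
  then show ?thesis by (rule holomorphic_map_onI)
qed

lemma continuous_on_det_cjac:
  fixes f :: "complex^'n \<Rightarrow> complex^'n"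
  assumes "holomorphic_map_on f S" "open S"
  shows "continuous_on S (\<lambda>x. det (cjac f x))"
  unfolding det_def cjac_entry
  by (intro continuous_intros holomorphic_map_on_imp_continuous_on
      holomorphic_map_on_directional_derivative assms)

text \<open>The entries of \<open>cjac f\<close> are components of derivatives along the axes, and
  the determinant is a polynomial in them. The inner map \<open>h\<close> will be the inverse of
  \<open>f\<close> for Osgood's theorem and the identity for Hurwitz's theorem.\<close>

lemma holomorphic_on_det_cjac_line:
  fixes f h :: "complex^'n \<Rightarrow> complex^'n"
  assumes f: "holomorphic_map_on f S" "open S" and h: "holomorphic_map_on h T" "open T" "h ` T \<subseteq> S"
    and U: "\<And>\<zeta>. \<zeta> \<in> U \<Longrightarrow> x + \<zeta> *s v \<in> T"
  shows "(\<lambda>\<zeta>. det (cjac f (h (x + \<zeta> *s v)))) holomorphic_on U"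
proof -
  have "(\<lambda>\<zeta>. cjac f (h (x + \<zeta> *s v)) $ i $ j) holomorphic_on U" for i j
    using holomorphic_on_line[OF holomorphic_map_on_compose(1)[OF h(1)
        holomorphic_map_on_directional_derivative[OF f, of "axis j 1"] h(2) f(2) h(3)] h(2) U, of U i]
    by (simp add: cjac_entry[of f])
  then show ?thesis
    unfolding det_def by (intro holomorphic_intros)
qed

text \<open>Sard's theorem is available only for \<open>real^'m\<close> with a well-ordered index type;
  \<open>'n bit0\<close> is such a type, of cardinality \<open>2 * CARD('n)\<close>.\<close>

lemma exists_det_cjac_nonzero:
  fixes f :: "complex^'n \<Rightarrow> complex^'n"
  assumes f: "holomorphic_map_on f S" "open S" and inj: "inj_on f S" and "S \<noteq> {}"
  shows "\<exists>x\<in>S. det (cjac f x) \<noteq> 0"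
proof (rule ccontr)
  assume "\<not> ?thesis"
  then have det0: "det (cjac f x) = 0" if "x \<in> S" for x using that by blast
  have "DIM(complex^'n) = DIM(real^('n bit0))"
    by simp
  from isomorphisms_UNIV_UNIV[OF this]
  obtain a :: "complex^'n \<Rightarrow> real^('n bit0)" and b where ab: "linear a" "linear b"
    "\<And>x. b (a x) = x" "\<And>y. a (b y) = y"
    by metis
  have bl: "bounded_linear a" "bounded_linear b"
    using ab(1,2) by (simp_all add: linear_conv_bounded_linear)
  define T where "T = b -` S"
  define F where "F = a \<circ> f \<circ> b"
  have der: "(F has_derivative (a \<circ> (*v) (cjac f (b y)) \<circ> b)) (at y)" if "y \<in> T" for y
    unfolding F_def using that bl
    by (intro diff_chain_at has_derivative_cjac[OF f] bounded_linear_imp_has_derivative) (auto simp: T_def)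
  \<comment> \<open>Everywhere singular derivatives make the image negligible by Sard's theorem,
    whereas invariance of domain makes it open. Conjugation by the real isomorphism \<open>a\<close>
    preserves the failure of injectivity, so the real rank drops.\<close>
  have "negligible (F ` T)"
  proof (rule baby_Sard)
    fix y assume "y \<in> T"
    show "(F has_derivative (a \<circ> (*v) (cjac f (b y)) \<circ> b)) (at y within T)"
      using der[OF \<open>y \<in> T\<close>] by (rule has_derivative_at_withinI)
    have "\<not> invertible (cjac f (b y))"
      using det0[of "b y"] \<open>y \<in> T\<close> by (simp add: T_def invertible_det_nz)
    then have "\<not> inj ((*v) (cjac f (b y)))"
      by (simp add: invertible_left_inverse matrix_left_invertible_injective)
    then obtain v w where vw: "v \<noteq> w" "cjac f (b y) *v v = cjac f (b y) *v w"
      by (auto simp: inj_def)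
    let ?L = "a \<circ> (*v) (cjac f (b y)) \<circ> b"
    have "?L (a v) = ?L (a w)" "a v \<noteq> a w"
      using vw ab(3) by (auto, metis)
    moreover have "linear ?L"
      using has_derivative_linear[OF der[OF \<open>y \<in> T\<close>]] by simp
    then have "matrix ?L *v x = ?L x" for x
      by (rule matrix_works[OF linear_matrix_vector_mul_eq[THEN iffD2]]) 
    ultimately have "\<not> inj ((*v) (matrix ?L))"
      by (metis injD)
    then show "rank (matrix ?L) < CARD('n bit0)"
      by (simp only: less_rank_noninjective not_False_eq_True)
  qed simp
  moreover have "open T"
    unfolding T_def using bl(2) \<open>open S\<close>
    by (intro open_vimage) (auto intro: linear_continuous_on)
  moreover have "T \<noteq> {}"
    using \<open>S \<noteq> {}\<close> ab(3) by (force simp: T_def)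
  moreover have "open (F ` T)"
  proof (rule invariance_of_domain[OF _ \<open>open T\<close>])
    show "continuous_on T F"
      using der has_derivative_continuous continuous_at_imp_continuous_on by blast
    show "inj_on F T"
      using inj ab unfolding inj_on_def F_def T_def by (metis comp_apply vimageD)
  qed
  ultimately show False
    using open_not_negligible by blast
qed

section \<open>Osgood's theorem\<close>

text \<open>\<open>G ^ N * u\<close> vanishes on the part of the frontier where \<open>u = 0\<close>, so the maximum modulus
  principle applies to it; taking \<open>N\<close>-th roots removes the factor \<open>u\<close> as \<open>N \<rightarrow> \<infinity>\<close>.\<close>

lemma maximum_modulus_off_zeros:
  fixes G u :: "complex \<Rightarrow> complex" and r :: real
  defines "W \<equiv> {\<zeta> \<in> ball 0 r. u \<zeta> \<noteq> 0}"
  assumes G: "continuous_on (cball 0 r) G" "G holomorphic_on W"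
    and u: "continuous_on (cball 0 r) u" "u holomorphic_on W"
    and M: "\<And>\<zeta>. cmod \<zeta> = r \<Longrightarrow> cmod (G \<zeta>) \<le> M"
    and \<xi>: "\<xi> \<in> W"
  shows "cmod (G \<xi>) \<le> M"
proof (rule ccontr)
  assume "\<not> ?thesis"
  then have gt: "M < cmod (G \<xi>)" by simp
  have "r > 0"
    using \<xi> unfolding W_def by (metis (lifting) ball_eq_empty empty_iff mem_Collect_eq not_less)
  have "M \<ge> 0"
    using order_trans[OF norm_ge_zero M[of "of_real r"]] \<open>r > 0\<close> by simp
  have "compact (u ` cball 0 r)"
    using u(1) by (intro compact_continuous_image) auto
  then obtain B where B: "\<And>\<zeta>. \<zeta> \<in> cball 0 r \<Longrightarrow> cmod (u \<zeta>) \<le> B"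
    by (metis bounded_iff compact_imp_bounded imageI)
  have "W = ball 0 r \<inter> u -` (- {0})"
    by (auto simp: W_def)
  moreover have "continuous_on (ball 0 r) u"
    using u(1) continuous_on_subset ball_subset_cball by blast
  ultimately have "open W"
    using continuous_open_preimage[of "ball 0 r" u "- {0}"] by (simp add: open_Compl)
  have clW: "closure W \<subseteq> cball 0 r"
    by (rule closure_minimal) (auto simp: W_def)
  have key: "cmod (G \<xi>) ^ N * cmod (u \<xi>) \<le> M ^ N * B" for N
  proof -
    have "cmod (G \<xi> ^ N * u \<xi>) \<le> M ^ N * B"
    proof (rule maximum_modulus_frontier[of "\<lambda>\<zeta>. G \<zeta> ^ N * u \<zeta>" W])
      show "(\<lambda>\<zeta>. G \<zeta> ^ N * u \<zeta>) holomorphic_on interior W"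
        using G u \<open>open W\<close> by (simp add: interior_open holomorphic_intros)
      show "continuous_on (closure W) (\<lambda>\<zeta>. G \<zeta> ^ N * u \<zeta>)"
        by (intro continuous_intros continuous_on_subset[OF G(1)] continuous_on_subset[OF u(1)] clW)
      show "bounded W"
        by (rule bounded_subset[of "ball 0 r"]) (auto simp: W_def)
      fix z assume z: "z \<in> frontier W"
      then have zc: "z \<in> cball 0 r" "z \<notin> W"
        using clW \<open>open W\<close> by (auto simp: frontier_def interior_open)
      show "cmod (G z ^ N * u z) \<le> M ^ N * B"
      proof (cases "z \<in> ball 0 r")
        case True
        then have "u z = 0"
          using zc by (simp add: W_def)
        moreover have "B \<ge> 0"
          using B[OF zc(1)] norm_ge_zero order_trans by blast
        ultimately show ?thesis
          using \<open>M \<ge> 0\<close> by simp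
      next
        case False
        then have "cmod z = r" using zc by simp
        then show ?thesis
          unfolding norm_mult norm_power using B[OF zc(1)] \<open>M \<ge> 0\<close> M[of z]
          by (intro mult_mono power_mono) auto
      qed
    qed (rule \<xi>)
    then show ?thesis by (simp add: norm_mult norm_power)
  qed
  have u0: "cmod (u \<xi>) > 0"
    using \<xi> by (simp add: W_def)
  show False
  \<comment> \<open>For \<open>M = 0\<close> there is no quotient by \<open>M\<close> to raise to
    powers, but the exponent 1 already gives a contradiction.\<close>
  proof (cases "M = 0")
    case True
    then have "cmod (G \<xi>) * cmod (u \<xi>) \<le> 0"
      using key[of 1] by simp
    then show False
      using mult_pos_pos[OF gt[unfolded True] u0] by linarith
  next
    case False
    then have "M > 0" using \<open>M \<ge> 0\<close> by simp
    then have "1 < cmod (G \<xi>) / M" using gt by simp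
    then obtain N where "B / cmod (u \<xi>) < (cmod (G \<xi>) / M) ^ N"
      using real_arch_pow by blast
    then have "B * M ^ N < cmod (G \<xi>) ^ N * cmod (u \<xi>)"
      using u0 \<open>M > 0\<close> by (simp add: power_divide field_simps)
    then show False
      using key[of N] by (simp add: mult.commute)
  qed
qed

lemma inv_into_open_image:
  fixes f :: "'a::euclidean_space \<Rightarrow> 'a"
  assumes "continuous_on S f" "open S" "inj_on f S"
  shows "open (f ` S)" "continuous_on (f ` S) (inv_into S f)"
proof -
  have *: "open (f ` U)" if "open U" "U \<subseteq> S" for U
    using that assms by (meson continuous_on_subset inj_on_subset invariance_of_domain)
  then show "open (f ` S)"
    using assms by blast
  show "continuous_on (f ` S) (inv_into S f)"
  proof (rule continuous_on_inverse_open_map[OF assms(1) refl])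
    show "inv_into S f (f x) = x" if "x \<in> S" for x
      using that assms(3) by (rule inv_into_f_f[rotated])
    show "openin (top_of_set (f ` S)) (f ` U)" if "openin (top_of_set S) U" for U
      using that *[of U] assms(2) by (simp add: open_subset openin_open_eq image_mono)
  qed
qed

lemma holomorphic_map_on_inverse:
  fixes f :: "complex^'n \<Rightarrow> complex^'n"
  assumes f: "holomorphic_map_on f S" "open S"
    and T: "open T" "continuous_on T g" "g ` T \<subseteq> S" "\<And>y. y \<in> T \<Longrightarrow> f (g y) = y"
    and det: "\<And>y. y \<in> T \<Longrightarrow> det (cjac f (g y)) \<noteq> 0"
  shows "holomorphic_map_on g T"
proof (rule holomorphic_map_onI)
  fix y assume y: "y \<in> T"
  have "invertible (cjac f (g y))"
    using det[OF y] by (simp add: invertible_det_nz)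
  then obtain B where B: "B ** cjac f (g y) = mat 1"
    by (auto simp: invertible_left_inverse)
  have "(g has_derivative (*v) B) (at y)"
  proof (rule has_derivative_inverse_basic[where f = f and T = T])
    show "(f has_derivative (*v) (cjac f (g y))) (at (g y))"
      using has_derivative_cjac[OF f] T(3) y by blast
    show "(*v) B \<circ> (*v) (cjac f (g y)) = id"
      by (rule ext) (simp add: matrix_vector_mul_assoc B)
    show "continuous (at y) g"
      using T(1,2) y continuous_on_eq_continuous_at by blast
  qed (use T y in \<open>simp_all add: bounded_linear_matrix_vector_mult\<close>)
  then show "(g has_derivative (*v) (cjac g y)) (at y)"
    using cjac_eqI by metis
qed

text \<open>The inverse is continuous and holomorphic off the zero set of \<open>u = det (cjac f) \<circ> g\<close>.
  Applying the maximum principle to its difference quotients on complex lines, whose values on a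
  fixed sphere are bounded, shows that it is locally Lipschitz; hence the derivative of \<open>f\<close> is
  injective.\<close>

theorem det_cjac_nonzero_if_inj:
  fixes f :: "complex^'n \<Rightarrow> complex^'n"
  assumes f: "holomorphic_map_on f S" "open S" and inj: "inj_on f S" and x: "x \<in> S"
  shows "det (cjac f x) \<noteq> 0"
proof -
  define T where "T = f ` S"
  define g where "g = inv_into S f"
  have contf: "continuous_on S f"
    using f(1) by (rule holomorphic_map_on_imp_continuous_on)
  have T: "open T" "continuous_on T g"
    unfolding T_def g_def using inv_into_open_image[OF contf f(2) inj] by auto
  have gT: "g ` T \<subseteq> S" and fg: "f (g y) = y" if "y \<in> T" for y
    using that by (auto simp: g_def T_def inv_into_into f_inv_into_f)
  have gf: "g (f y) = y" if "y \<in> S" for y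
    using that inj by (simp add: g_def)
  have gS: "g y \<in> S" if "y \<in> T" for y
    using that by (auto simp: g_def T_def inv_into_into)
  define u where "u = (\<lambda>y. det (cjac f (g y)))"
  have contu: "continuous_on T u"
    unfolding u_def using gS
    by (intro continuous_on_compose2[OF continuous_on_det_cjac[OF f] T(2)]) auto
  \<comment> \<open>On this open set the Jacobian matrix of \<open>f\<close> at the preimage is
    invertible, so \<open>g\<close> is holomorphic there by the inverse rule.\<close>
  define T0 where "T0 = {y \<in> T. u y \<noteq> 0}"
  have "T0 = T \<inter> u -` (- {0})"
    by (auto simp: T0_def)
  then have "open T0"
    using continuous_open_preimage[OF contu T(1), of "- {0}"] by (simp add: open_Compl)
  have T0T: "T0 \<subseteq> T" by (auto simp: T0_def)
  have holg: "holomorphic_map_on g T0"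
    using T0T gS fg
    by (intro holomorphic_map_on_inverse[OF f \<open>open T0\<close> continuous_on_subset[OF T(2)]])
       (auto simp: T0_def u_def)
  \<comment> \<open>\<open>f\<close> restricted to the preimage of \<open>V\<close> is again
    injective, so Sard's theorem yields a regular point in it.\<close>
  have dense: "\<exists>y\<in>V. y \<in> T0" if "open V" "V \<subseteq> T" "V \<noteq> {}" for V
  proof -
    let ?U = "S \<inter> f -` V"
    have "open ?U"
      using continuous_open_preimage[OF contf f(2) \<open>open V\<close>] .
    moreover have "?U \<noteq> {}"
      using that by (auto simp: T_def)
    ultimately obtain z where "z \<in> ?U" "det (cjac f z) \<noteq> 0"
      using exists_det_cjac_nonzero[of f ?U] f inj
      by (meson holomorphic_map_on_subset inf_le1 inj_on_subset)
    then show ?thesis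
      by (intro bexI[of _ "f z"]) (auto simp: T0_def T_def u_def gf)
  qed
  have "f x \<in> T" using x by (simp add: T_def)
  then obtain R where R: "R > 0" "cball (f x) R \<subseteq> T"
    using T(1) open_contains_cball by blast
  \<comment> \<open>Two points of the ball of radius \<open>r\<close> are less than
    \<open>2 * r\<close> apart, and the disc of radius \<open>2 * r\<close> about one of them, on
    the line through both, stays in \<open>cball (f x) (3 * r)\<close>.\<close>
  define r where "r = R / 3"
  have r: "r > 0" "cball (f x) (3 * r) \<subseteq> T" using R by (auto simp: r_def)
  have "compact (g ` cball (f x) (3 * r))"
    using T(2) r(2) by (intro compact_continuous_image) (auto intro: continuous_on_subset)
  then obtain M where M: "\<And>y. y \<in> cball (f x) (3 * r) \<Longrightarrow> norm (g y) \<le> M"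
    by (metis bounded_iff compact_imp_bounded imageI)
  define L where "L = CARD('n) * (M / r)"
  have lip0: "norm (g q - g p) \<le> L * norm (q - p)"
    if p: "p \<in> ball (f x) r" "p \<in> T0" and q: "q \<in> ball (f x) r" "q \<in> T0" for p q
  proof (cases "p = q")
    case False
    define e where "e = q - p"
    have e: "norm e > 0" "norm e < 2 * r"
      using False p(1) q(1) dist_triangle_less_add[of q "f x" r p r]
      by (auto simp: e_def dist_norm norm_minus_commute)
    \<comment> \<open>The parameter 1 belongs to \<open>q\<close>, and the circle of radius \<rho>
      to points at distance \<open>2 * r\<close> from \<open>p\<close>. There the difference
      quotient is at most \<open>2 * M / \<rho>\<close>, which is linear in
      \<open>norm e\<close>.\<close>
    define \<rho> where "\<rho> = 2 * r / norm e"
    have \<rho>: "\<rho> > 1" using e by (simp add: \<rho>_def)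
    have mem: "p + \<zeta> *s e \<in> cball (f x) (3 * r)" if "\<zeta> \<in> cball 0 \<rho>" for \<zeta>
    proof -
      have "norm (\<zeta> *s e) \<le> \<rho> * norm e"
        using that by (simp add: norm_vector_smult mult_right_mono)
      then have "dist p (p + \<zeta> *s e) \<le> 2 * r"
        using e by (simp add: \<rho>_def dist_norm)
      then show ?thesis
        using p(1) dist_triangle[of "f x" "p + \<zeta> *s e" p] by simp
    qed
    have memT: "p + \<zeta> *s e \<in> T" if "\<zeta> \<in> cball 0 \<rho>" for \<zeta>
      using mem[OF that] r(2) by blast
    have contline: "continuous_on A (\<lambda>\<zeta>. p + \<zeta> *s e)" for A
      by (intro continuous_intros linear_continuous_on bounded_linear_smult_left)
    define U where "U = (\<lambda>\<zeta>. u (p + \<zeta> *s e))"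
    define W where "W = {\<zeta> \<in> ball 0 \<rho>. U \<zeta> \<noteq> 0}"
    have contU: "continuous_on (cball 0 \<rho>) U"
      unfolding U_def using memT by (intro continuous_on_compose2[OF contu contline]) auto
    have "W = ball 0 \<rho> \<inter> U -` (- {0})"
      by (auto simp: W_def)
    then have "open W"
      using continuous_open_preimage[OF continuous_on_subset[OF contU ball_subset_cball] open_ball, of "- {0}"]
      by (simp add: open_Compl)
    have W01: "0 \<in> W" "1 \<in> W"
      using \<rho> p(2) q(2) by (auto simp: W_def U_def T0_def e_def)
    have WT0: "p + \<zeta> *s e \<in> T0" if "\<zeta> \<in> W" for \<zeta>
      using that memT[of \<zeta>] by (auto simp: W_def T0_def U_def)
    have holU: "U holomorphic_on W"
      unfolding U_def u_def
      using T0T gS WT0 by (intro holomorphic_on_det_cjac_line[OF f holg \<open>open T0\<close>]) auto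
    have "cmod ((g q - g p) $ i) \<le> M / r * norm (q - p)" for i
    proof -
      define k where "k = (\<lambda>\<zeta>. g (p + \<zeta> *s e) $ i)"
      have holk: "k holomorphic_on W"
        unfolding k_def using WT0 by (intro holomorphic_on_line[OF holg \<open>open T0\<close>])
      have contk: "continuous_on (cball 0 \<rho>) k"
        unfolding k_def using memT by (intro continuous_intros continuous_on_compose2[OF T(2) contline]) auto
      \<comment> \<open>The difference quotient of \<open>k\<close> at 0, completed by the
        derivative. Its value at 1 is the increment from \<open>p\<close> to \<open>q\<close> of a
        component of \<open>g\<close>.\<close>
      define G where "G = (\<lambda>\<zeta>. if \<zeta> = 0 then deriv k 0 else (k \<zeta> - k 0) / (\<zeta> - 0))"
      have holG: "G holomorphic_on W"
        unfolding G_def using W01(1) \<open>open W\<close> by (intro pole_lemma[OF holk]) (simp add: interior_open)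
      have "continuous_on (cball 0 \<rho> - {0}) (\<lambda>\<zeta>. (k \<zeta> - k 0) / (\<zeta> - 0))"
        by (intro continuous_intros continuous_on_subset[OF contk]) auto
      then have "continuous_on (cball 0 \<rho> - {0}) G"
        by (rule continuous_on_eq) (simp add: G_def)
      \<comment> \<open>\<open>G\<close> is holomorphic on the open neighbourhood \<open>W\<close>
        of 0; away from 0 the quotient is continuous because \<open>k\<close> is.\<close>
      moreover have "W \<union> (cball 0 \<rho> - {0}) = cball 0 \<rho>"
        using W01 by (auto simp: W_def)
      ultimately have "continuous_on (cball 0 \<rho>) G"
        using continuous_on_Un_local_open[of W "cball 0 \<rho> - {0}" G] \<open>open W\<close>
          holomorphic_on_imp_continuous_on[OF holG]
        by (metis openin_delete openin_subtopology_self open_subset sup_ge1)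
      moreover have "cmod (G \<zeta>) \<le> M / r * norm e" if "cmod \<zeta> = \<rho>" for \<zeta>
      proof -
        have kM: "cmod (k \<zeta>) \<le> M" if "\<zeta> \<in> cball 0 \<rho>" for \<zeta>
          using M[OF mem[OF that]] unfolding k_def
          by (meson Finite_Cartesian_Product.norm_nth_le order_trans)
        have "cmod (k \<zeta> - k 0) \<le> 2 * M"
          using kM[of \<zeta>] kM[of 0] that \<rho> norm_triangle_ineq4[of "k \<zeta>" "k 0"] by auto
        then have "cmod (k \<zeta> - k 0) / \<rho> \<le> 2 * M / \<rho>"
          using \<rho> by (intro divide_right_mono) auto
        then show ?thesis
          using that \<rho> by (auto simp: G_def norm_divide \<rho>_def)
      qed
      ultimately have "cmod (G 1) \<le> M / r * norm e"
        using maximum_modulus_off_zeros[of \<rho> G U "M / r * norm e" 1] holG contU holU W01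
        unfolding W_def by blast
      then show ?thesis
        by (simp add: G_def k_def e_def)
    qed
    then show ?thesis
      using norm_le_card_bound[of "g q - g p" "M / r * norm (q - p)"] by (simp add: L_def mult.assoc)
  qed simp
  \<comment> \<open>Density of \<open>T0\<close> and continuity of \<open>g\<close> extend the
    Lipschitz bound to the whole ball.\<close>
  have clos: "p \<in> closure (ball (f x) r \<inter> T0)" if "p \<in> ball (f x) r" for p
    unfolding closure_approachable
  proof (intro allI impI)
    fix e :: real assume "e > 0"
    have "ball p e \<inter> ball (f x) r \<subseteq> T"
      using r by auto
    moreover have "p \<in> ball p e \<inter> ball (f x) r"
      using that \<open>e > 0\<close> by simp
    ultimately obtain y where "y \<in> ball p e \<inter> ball (f x) r" "y \<in> T0"
      using dense[OF open_Int[OF open_ball open_ball]] by blast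
    then show "\<exists>y\<in>ball (f x) r \<inter> T0. dist y p < e"
      by (auto simp: dist_commute)
  qed
  have ballT: "p \<in> T" if "p \<in> ball (f x) r" for p
    using that r by auto
  have lip: "norm (g q - g p) \<le> L * norm (q - p)"
    if p: "p \<in> ball (f x) r" and q: "q \<in> ball (f x) r" for p q
  proof -
    obtain P Q where P: "\<And>n. P n \<in> ball (f x) r \<inter> T0" "P \<longlonglongrightarrow> p"
      and Q: "\<And>n. Q n \<in> ball (f x) r \<inter> T0" "Q \<longlonglongrightarrow> q"
      using clos[OF p] clos[OF q] unfolding closure_sequential by metis
    have gP: "(\<lambda>n. g (P n)) \<longlonglongrightarrow> g p"
      using P by (intro continuous_on_tendsto_compose[OF T(2)] ballT p always_eventually) (auto simp: ballT)
    have gQ: "(\<lambda>n. g (Q n)) \<longlonglongrightarrow> g q"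
      using Q by (intro continuous_on_tendsto_compose[OF T(2)] ballT q always_eventually) (auto simp: ballT)
    show ?thesis
    proof (rule LIMSEQ_le)
      show "(\<lambda>n. norm (g (Q n) - g (P n))) \<longlonglongrightarrow> norm (g q - g p)"
        by (intro tendsto_intros gP gQ)
      show "(\<lambda>n. L * norm (Q n - P n)) \<longlonglongrightarrow> L * norm (q - p)"
        by (intro tendsto_intros P Q)
      show "\<exists>N. \<forall>n\<ge>N. norm (g (Q n) - g (P n)) \<le> L * norm (Q n - P n)"
        using lip0 P(1) Q(1) by blast
    qed
  qed
  have L: "L \<ge> 0"
    using M[of "f x"] norm_ge_zero[of "g (f x)"] r(1) by (simp add: L_def del: norm_ge_zero)
  have "v = 0" if v: "cjac f x *v v = 0" for v
  proof (rule ccontr)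
    assume "v \<noteq> 0"
    have der: "(f has_derivative (*v) (cjac f x)) (at x)"
      by (rule has_derivative_cjac[OF f x])
    \<comment> \<open>If \<open>v\<close> lies in the kernel, a short displacement along
      \<open>v\<close> changes \<open>f\<close> by at most \<open>1 / (2 * (L + 1))\<close> times
      its length. Multiplied by the Lipschitz constant \<open>L\<close> of the inverse, this is less
      than the length itself.\<close>
    have "1 / (2 * (L + 1)) > 0"
      using L by simp
    then obtain d where d: "d > 0" "\<And>y. norm (y - x) < d \<Longrightarrow>
        norm (f y - f x - cjac f x *v (y - x)) \<le> 1 / (2 * (L + 1)) * norm (y - x)"
      using der unfolding has_derivative_at_alt by metis
    have "open (S \<inter> f -` ball (f x) r)"
      using continuous_open_preimage[OF contf f(2) open_ball] .
    moreover have "x \<in> S \<inter> f -` ball (f x) r"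
      using x r by simp
    ultimately obtain d' where d': "d' > 0" "ball x d' \<subseteq> S \<inter> f -` ball (f x) r"
      using open_contains_ball by blast
    define t where "t = min d d' / 2 / norm v"
    have t: "t > 0" using d d' \<open>v \<noteq> 0\<close> by (simp add: t_def)
    define y where "y = x + t *\<^sub>R v"
    have yx: "norm (y - x) = min d d' / 2"
      using \<open>v \<noteq> 0\<close> d(1) d'(1) by (simp add: y_def t_def)
    then have "y \<in> ball x d'"
      using d d' by (auto simp: dist_norm norm_minus_commute min_def split: if_splits)
    then have y: "y \<in> S" "f y \<in> ball (f x) r"
      using d' by auto
    have "cjac f x *v (y - x) = complex_of_real t *s (cjac f x *v v)"
      by (simp only: y_def add_diff_cancel_left' of_real_smult_eq_scaleR[symmetric] vec.scale)
    then have "cjac f x *v (y - x) = 0"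
      using v by (simp add: vec_eq_iff)
    then have "norm (f y - f x) \<le> 1 / (2 * (L + 1)) * norm (y - x)"
      using d(2)[of y] yx d(1) d'(1) by fastforce
    moreover have "norm (y - x) \<le> L * norm (f y - f x)"
      using lip[of "f x" "f y"] y r x by (simp add: gf)
    ultimately have "norm (y - x) \<le> L * (1 / (2 * (L + 1)) * norm (y - x))"
      using L mult_left_mono order_trans by blast
    also have "\<dots> = L / (2 * (L + 1)) * norm (y - x)"
      by simp
    also have "\<dots> < 1 * norm (y - x)"
      using L yx d(1) d'(1) by (intro mult_strict_right_mono) (auto simp: field_simps)
    finally show False by simp
  qed
  then have "invertible (cjac f x)"
    by (simp add: invertible_left_inverse matrix_left_invertible_ker)
  then show ?thesis
    by (simp add: invertible_det_nz)
qed

text \<open>By Osgood's theorem the Jacobian never vanishes, so the inverse rule applies on the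
  whole image.\<close>

corollary holomorphic_map_on_inv_into:
  fixes f :: "complex^'n \<Rightarrow> complex^'n"
  assumes f: "holomorphic_map_on f S" "open S" and inj: "inj_on f S"
  shows "holomorphic_map_on (inv_into S f) (f ` S)"
  using inv_into_open_image[OF holomorphic_map_on_imp_continuous_on[OF f(1)] f(2) inj]
  by (intro holomorphic_map_on_inverse[OF f] det_cjac_nonzero_if_inj[OF f inj])
     (auto simp: inv_into_into f_inv_into_f)

section \<open>Normal families\<close>

lemma loc_bounded_holomorphicE:
  assumes "loc_bounded_holomorphic f S" "x \<in> S"
  obtains R M where "R > 0" "M \<ge> 0" "\<forall>\<^sub>F j in sequentially.
      holomorphic_map_on (f j) (ball x R) \<and> (\<forall>y\<in>ball x R. norm (f j y) \<le> M)"
proof -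
  obtain R M where *: "R > 0" "\<forall>\<^sub>F j in sequentially.
      holomorphic_map_on (f j) (ball x R) \<and> (\<forall>y\<in>ball x R. norm (f j y) \<le> M)"
    using assms unfolding loc_bounded_holomorphic_def by blast
  then obtain j where "norm (f j x) \<le> M"
    using eventually_happens[OF *(2)] by force
  then have "M \<ge> 0"
    using norm_ge_zero order_trans by blast
  with * that show ?thesis by blast
qed

text \<open>Cauchy's first bound, with constants common to all large \<open>j\<close>, gives
  equicontinuity. Two points within \<open>R / 8\<close> of \<open>x\<close> are less than
  \<open>R / 4\<close> apart, half the radius of a ball that stays in
  \<open>ball x R\<close>.\<close>

lemma loc_bounded_holomorphic_lipschitz:
  fixes f :: "nat \<Rightarrow> complex^'n \<Rightarrow> complex^'m"
  assumes "loc_bounded_holomorphic f S" "x \<in> S"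
  obtains r L where "r > 0" "L \<ge> 0" "\<forall>\<^sub>F j in sequentially.
      \<forall>y\<in>ball x r. \<forall>y'\<in>ball x r. norm (f j y' - f j y) \<le> L * norm (y' - y)"
proof -
  obtain R M where R: "R > 0" "M \<ge> 0" and ev: "\<forall>\<^sub>F j in sequentially.
      holomorphic_map_on (f j) (ball x R) \<and> (\<forall>y\<in>ball x R. norm (f j y) \<le> M)"
    using assms by (rule loc_bounded_holomorphicE)
  define L where "L = CARD('m) * (2 * M / (R / 2))"
  have "\<forall>\<^sub>F j in sequentially.
      \<forall>y\<in>ball x (R / 8). \<forall>y'\<in>ball x (R / 8). norm (f j y' - f j y) \<le> L * norm (y' - y)"
    using ev
  proof eventually_elim
    case (elim j)
    show ?case
    proof (intro ballI)
      fix y y' assume y: "y \<in> ball x (R / 8)" "y' \<in> ball x (R / 8)"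
      have "dist y x + R / 2 \<le> R"
        using y(1) R(1) by (simp add: dist_commute)
      then have sub: "ball y (R / 2) \<subseteq> ball x R"
        by (simp add: ball_subset_ball_iff)
      have "dist y' y < R / 8 + R / 8"
        using y by (intro dist_triangle_less_add[of _ x]) (auto simp: dist_commute)
      then have "norm (y' - y) < R / 2 / 2"
        using R by (simp add: dist_norm)
      then show "norm (f j y' - f j y) \<le> L * norm (y' - y)"
        unfolding L_def using elim sub
        by (intro cauchy_vector_bounds(1)) (auto intro: holomorphic_map_on_subset)
    qed
  qed
  then show ?thesis
    using that[of "R / 8" L] R by (simp add: L_def)
qed

lemma loc_bounded_holomorphic_subset:
  "loc_bounded_holomorphic f S \<Longrightarrow> T \<subseteq> S \<Longrightarrow> loc_bounded_holomorphic f T"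
  unfolding loc_bounded_holomorphic_def by blast

lemma loc_bounded_holomorphic_subseq:
  assumes "loc_bounded_holomorphic f S" "strict_mono k"
  shows "loc_bounded_holomorphic (\<lambda>j. f (k j)) S"
  unfolding loc_bounded_holomorphic_def
proof
  fix x assume "x \<in> S"
  then obtain R M where "R > 0" "\<forall>\<^sub>F j in sequentially.
      holomorphic_map_on (f j) (ball x R) \<and> (\<forall>y\<in>ball x R. norm (f j y) \<le> M)"
    using assms(1) by (blast elim: loc_bounded_holomorphicE)
  then show "\<exists>R>0. \<exists>M. \<forall>\<^sub>F j in sequentially.
      holomorphic_map_on (f (k j)) (ball x R) \<and> (\<forall>y\<in>ball x R. norm (f (k j) y) \<le> M)"
    using eventually_subseq[OF assms(2)] by blast
qed

text \<open>Equicontinuity lets the argument move with the index. This identifies limits of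
  compositions such as \<open>H n (G n x)\<close>, where both maps vary together.\<close>

lemma loc_bounded_holomorphic_tendsto:
  fixes f :: "nat \<Rightarrow> complex^'n \<Rightarrow> complex^'m"
  assumes f: "loc_bounded_holomorphic f S" and x: "x \<in> S"
    and lim: "(\<lambda>j. f j x) \<longlonglongrightarrow> l" and X: "X \<longlonglongrightarrow> x"
  shows "(\<lambda>j. f j (X j)) \<longlonglongrightarrow> l"
proof -
  obtain r L where r: "r > 0" "L \<ge> 0" and ev: "\<forall>\<^sub>F j in sequentially.
      \<forall>y\<in>ball x r. \<forall>y'\<in>ball x r. norm (f j y' - f j y) \<le> L * norm (y' - y)"
    using loc_bounded_holomorphic_lipschitz[OF f x] .
  have "\<forall>\<^sub>F j in sequentially. X j \<in> ball x r"
    using X r(1) by (intro topological_tendstoD) auto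
  with ev have "\<forall>\<^sub>F j in sequentially. norm (f j (X j) - f j x) \<le> norm (L * norm (X j - x))"
    by eventually_elim (use r in auto)
  moreover have "(\<lambda>j. L * norm (X j - x)) \<longlonglongrightarrow> 0"
    using tendsto_mult[OF tendsto_const[of L] tendsto_norm[OF LIM_zero[OF X]]] by simp
  ultimately have "(\<lambda>j. f j (X j) - f j x) \<longlonglongrightarrow> 0"
    by (rule Lim_transform_bound)
  from tendsto_add[OF this lim] show ?thesis by simp
qed

text \<open>Equicontinuity makes pointwise convergence uniform on a small ball around each point,
  and finitely many such balls cover \<open>K\<close>.\<close>

lemma loc_bounded_holomorphic_uniform_limit:
  fixes f :: "nat \<Rightarrow> complex^'n \<Rightarrow> complex^'m"
  assumes f: "loc_bounded_holomorphic f S"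
    and lim: "\<And>x. x \<in> S \<Longrightarrow> (\<lambda>j. f j x) \<longlonglongrightarrow> g x"
    and K: "compact K" "K \<subseteq> S" and "open S"
  shows "uniform_limit K f g sequentially"
proof (rule uniform_limitI)
  fix e :: real assume "e > 0"
  have "\<exists>r>0. \<forall>\<^sub>F j in sequentially. \<forall>y\<in>ball x r. dist (f j y) (g y) < e" if x: "x \<in> S" for x
  proof -
    obtain r L where r: "r > 0" "L \<ge> 0" and ev: "\<forall>\<^sub>F j in sequentially.
        \<forall>y\<in>ball x r. \<forall>y'\<in>ball x r. norm (f j y' - f j y) \<le> L * norm (y' - y)"
      using loc_bounded_holomorphic_lipschitz[OF f x] .
    have "continuous_on S g"
      using holomorphic_limit(1)[OF f \<open>open S\<close> lim] holomorphic_map_on_imp_continuous_on by blast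
    then have "isCont g x"
      using x \<open>open S\<close> continuous_on_eq_continuous_at by blast
    then obtain d where d: "d > 0" "\<And>y. dist y x < d \<Longrightarrow> dist (g y) (g x) < e / 3"
      using \<open>e > 0\<close> unfolding continuous_at_eps_delta by (metis divide_pos_pos zero_less_numeral)
    \<comment> \<open>Within distance \<open>s\<close> of \<open>x\<close> both \<open>f j\<close>,
      by the Lipschitz constant, and \<open>g\<close>, by continuity, vary by less than
      \<open>e / 3\<close>; \<open>L + 1\<close> guards against \<open>L = 0\<close>.\<close>
    define s where "s = min r (min d (e / (3 * (L + 1))))"
    have s: "s > 0" using r d \<open>e > 0\<close> by (simp add: s_def)
    have "(L + 1) * s \<le> (L + 1) * (e / (3 * (L + 1)))"
      using r(2) by (intro mult_left_mono) (auto simp: s_def)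
    also have "\<dots> = e / 3" using r(2) by (simp add: field_simps)
    finally have Ls: "L * s < e / 3" using s by (simp add: algebra_simps)
    have "\<forall>\<^sub>F j in sequentially. dist (f j x) (g x) < e / 3"
      using lim[OF x] \<open>e > 0\<close> by (intro tendstoD) auto
    with ev have "\<forall>\<^sub>F j in sequentially. \<forall>y\<in>ball x s. dist (f j y) (g y) < e"
    proof eventually_elim
      case (elim j)
      show ?case
      proof
        fix y assume y: "y \<in> ball x s"
        then have "norm (f j y - f j x) \<le> L * norm (y - x)"
          using elim(1) r(1) by (auto simp: s_def)
        also have "\<dots> \<le> L * s"
          using y r(2) by (intro mult_left_mono) (auto simp: dist_norm norm_minus_commute)
        finally have "dist (f j y) (f j x) < e / 3"
          using Ls by (simp add: dist_norm)
        moreover have "dist (g x) (g y) < e / 3"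
          using d(2)[of y] y by (simp add: s_def dist_commute)
        ultimately show "dist (f j y) (g y) < e"
          using elim(2) dist_triangle[of "f j y" "g y" "f j x"] dist_triangle[of "f j x" "g y" "g x"]
          by linarith
      qed
    qed
    with s show ?thesis by blast
  qed
  then have "\<forall>x\<in>S. \<exists>r. r > 0 \<and> (\<forall>\<^sub>F j in sequentially. \<forall>y\<in>ball x r. dist (f j y) (g y) < e)"
    by blast
  from bchoice[OF this] obtain r where r: "\<And>x. x \<in> S \<Longrightarrow> r x > 0"
    "\<And>x. x \<in> S \<Longrightarrow> \<forall>\<^sub>F j in sequentially. \<forall>y\<in>ball x (r x). dist (f j y) (g y) < e"
    by blast
  have "K \<subseteq> (\<Union>x\<in>K. ball x (r x))"
    using r(1) K(2) by force
  then obtain C where C: "C \<subseteq> K" "finite C" "K \<subseteq> (\<Union>x\<in>C. ball x (r x))"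
    using compactE_image[OF K(1), of K "\<lambda>x. ball x (r x)"] by blast
  have "\<forall>x\<in>C. \<forall>\<^sub>F j in sequentially. \<forall>y\<in>ball x (r x). dist (f j y) (g y) < e"
    using r(2) C(1) K(2) by blast
  with C(2) have "\<forall>\<^sub>F j in sequentially. \<forall>x\<in>C. \<forall>y\<in>ball x (r x). dist (f j y) (g y) < e"
    by (rule eventually_ball_finite)
  then show "\<forall>\<^sub>F j in sequentially. \<forall>y\<in>K. dist (f j y) (g y) < e"
    by eventually_elim (use C(3) in blast)
qed

text \<open>For a fixed step \<open>s\<close> along \<open>w\<close>, the derivative is a difference
  of two values minus a Taylor remainder, divided by \<open>s\<close>; all of these are bounded
  independently of \<open>j\<close>. Hence the convergence theorems also apply to
  derivatives.\<close>

lemma loc_bounded_holomorphic_directional_derivative: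
  fixes f :: "nat \<Rightarrow> complex^'n \<Rightarrow> complex^'m"
  assumes f: "loc_bounded_holomorphic f S"
  shows "loc_bounded_holomorphic (\<lambda>j y. cjac (f j) y *v w) S"
  unfolding loc_bounded_holomorphic_def
proof
  fix x assume "x \<in> S"
  then obtain R M where R: "R > 0" "M \<ge> 0" and ev: "\<forall>\<^sub>F j in sequentially.
      holomorphic_map_on (f j) (ball x R) \<and> (\<forall>y\<in>ball x R. norm (f j y) \<le> M)"
    using f by (blast elim: loc_bounded_holomorphicE)
  \<comment> \<open>This keeps \<open>s * norm w\<close> below \<open>R / 4\<close>, half the radius
    of the balls on which the Taylor bound is used; the summand 1 covers
    \<open>w = 0\<close>.\<close>
  define s where "s = R / (8 * (norm w + 1))"
  have "s > 0" using R by (simp add: s_def add_nonneg_pos)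
  have "s * norm w \<le> s * (norm w + 1)"
    using \<open>s > 0\<close> by simp
  also have "\<dots> = R / 8"
    unfolding s_def using norm_ge_zero[of w] by (simp add: field_simps add_nonneg_eq_0_iff)
  finally have sw: "s * norm w < R / 4"
    using R by simp
  define A where "A = CARD('m) * (8 * M / (R / 2)^2)"
  define B where "B = (2 * M + A * (s * norm w) ^ 2) / s"
  have "\<forall>\<^sub>F j in sequentially. holomorphic_map_on (\<lambda>y. cjac (f j) y *v w) (ball x (R / 2)) \<and>
      (\<forall>y\<in>ball x (R / 2). norm (cjac (f j) y *v w) \<le> B)"
    using ev
  proof eventually_elim
    case (elim j)
    show ?case
    proof (intro conjI ballI)
      have "ball x (R / 2) \<subseteq> ball x R"
        using R by (intro subset_ball) auto
      then show "holomorphic_map_on (\<lambda>y. cjac (f j) y *v w) (ball x (R / 2))"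
        using elim holomorphic_map_on_directional_derivative[of "f j" "ball x R" w]
        by (auto intro: holomorphic_map_on_subset)
      fix y assume y: "y \<in> ball x (R / 2)"
      have sub: "ball y (R / 2) \<subseteq> ball x R"
        using y by (intro ball_subset_ball_iff[THEN iffD2]) (simp add: dist_commute)
      have nw: "norm (s *\<^sub>R w) = s * norm w" using \<open>s > 0\<close> by simp
      have mem: "y \<in> ball y (R / 2)" "y + s *\<^sub>R w \<in> ball y (R / 2)"
        using R sw nw by (auto simp: dist_norm)
      have "norm (f j (y + s *\<^sub>R w) - f j y - cjac (f j) y *v (y + s *\<^sub>R w - y))
          \<le> A * norm (y + s *\<^sub>R w - y) ^ 2"
        unfolding A_def using elim sub sw nw
        by (intro cauchy_vector_bounds(2)) (auto intro: holomorphic_map_on_subset)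
      then have "norm (f j (y + s *\<^sub>R w) - f j y - cjac (f j) y *v (s *\<^sub>R w)) \<le> A * (s * norm w) ^ 2"
        by (simp only: add_diff_cancel_left' nw)
      moreover have "norm (f j (y + s *\<^sub>R w)) \<le> M" "norm (f j y) \<le> M"
        using elim mem sub by blast+
      moreover have tri: "norm (a - b - c) \<le> norm a + norm b + norm c" for a b c :: "complex^'m"
        using norm_triangle_ineq4[of "a - b" c] norm_triangle_ineq4[of a b] by linarith
      have eq: "cjac (f j) y *v (s *\<^sub>R w) = f j (y + s *\<^sub>R w) - f j y
          - (f j (y + s *\<^sub>R w) - f j y - cjac (f j) y *v (s *\<^sub>R w))"
        by simp
      have "norm (cjac (f j) y *v (s *\<^sub>R w)) \<le> norm (f j (y + s *\<^sub>R w)) + norm (f j y)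
          + norm (f j (y + s *\<^sub>R w) - f j y - cjac (f j) y *v (s *\<^sub>R w))"
        by (rule order_trans[OF eq_refl[OF arg_cong[where f = norm, OF eq]] tri])
      ultimately have "norm (cjac (f j) y *v (s *\<^sub>R w)) \<le> 2 * M + A * (s * norm w) ^ 2"
        by linarith
      moreover have "cjac (f j) y *v (s *\<^sub>R w) = s *\<^sub>R (cjac (f j) y *v w)"
        by (metis of_real_smult_eq_scaleR vec.scale)
      ultimately show "norm (cjac (f j) y *v w) \<le> B"
        using \<open>s > 0\<close> by (simp add: B_def pos_le_divide_eq mult.commute)
    qed
  qed
  moreover have "R / 2 > 0" using R by simp
  ultimately show "\<exists>R>0. \<exists>M. \<forall>\<^sub>F j in sequentially. holomorphic_map_on (\<lambda>y. cjac (f j) y *v w) (ball x R) \<and>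
      (\<forall>y\<in>ball x R. norm (cjac (f j) y *v w) \<le> M)"
    by blast
qed

section \<open>Hurwitz's theorem for Jacobian determinants\<close>

lemma uniform_limit_sum:
  fixes f :: "'i \<Rightarrow> 'j \<Rightarrow> 'x \<Rightarrow> complex"
  assumes "finite I" "\<And>i. i \<in> I \<Longrightarrow> uniform_limit K (f i) (g i) F"
  shows "uniform_limit K (\<lambda>j x. \<Sum>i\<in>I. f i j x) (\<lambda>x. \<Sum>i\<in>I. g i x) F"
  using assms by (induction I) (auto intro!: uniform_limit_intros)

text \<open>The product rule for uniform limits asks for bounded limits, so boundedness of the
  partial product is carried through the induction.\<close>

lemma uniform_limit_prod:
  fixes f :: "'i \<Rightarrow> 'j \<Rightarrow> 'x \<Rightarrow> complex"
  assumes "finite I" "\<And>i. i \<in> I \<Longrightarrow> uniform_limit K (f i) (g i) F"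
    and "\<And>i. i \<in> I \<Longrightarrow> bounded (g i ` K)"
  shows "uniform_limit K (\<lambda>j x. \<Prod>i\<in>I. f i j x) (\<lambda>x. \<Prod>i\<in>I. g i x) F
    \<and> bounded ((\<lambda>x. \<Prod>i\<in>I. g i x) ` K)"
  using assms
proof (induction I)
  case empty
  then show ?case
    by (auto intro!: uniform_limit_intros finite_imp_bounded finite_subset[of _ "{1}"])
next
  case (insert i I)
  have "bounded ((\<lambda>x. g i x * (\<Prod>i\<in>I. g i x)) ` K)"
  proof -
    obtain a where a: "\<And>x. x \<in> K \<Longrightarrow> cmod (g i x) \<le> a"
      using insert.prems(2)[of i] by (auto simp: bounded_iff)
    have "bounded ((\<lambda>x. \<Prod>i\<in>I. g i x) ` K)"
      using insert by blast
    then obtain b where b: "\<And>x. x \<in> K \<Longrightarrow> cmod (\<Prod>i\<in>I. g i x) \<le> b"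
      unfolding bounded_iff by blast
    have "cmod (g i x * (\<Prod>i\<in>I. g i x)) \<le> a * b" if "x \<in> K" for x
      unfolding norm_mult using a[OF that] b[OF that] order_trans[OF norm_ge_zero a[OF that]]
      by (intro mult_mono) auto
    then show ?thesis
      by (auto simp: bounded_iff)
  qed
  moreover have "uniform_limit K (\<lambda>j x. f i j x * (\<Prod>i\<in>I. f i j x)) (\<lambda>x. g i x * (\<Prod>i\<in>I. g i x)) F"
    using insert by (intro uniform_lim_mult) auto
  ultimately show ?case
    using insert.hyps by simp
qed

text \<open>The entries are components of derivatives along the axes, which form locally bounded
  families; their pointwise convergence is therefore uniform on compact sets. The Leibniz formula
  carries this over to the determinant.\<close>

lemma uniform_limit_det_cjac:
  fixes f :: "nat \<Rightarrow> complex^'n \<Rightarrow> complex^'n"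
  assumes f: "loc_bounded_holomorphic f S"
    and lim: "\<And>x. x \<in> S \<Longrightarrow> (\<lambda>j. f j x) \<longlonglongrightarrow> g x"
    and K: "compact K" "K \<subseteq> S" and "open S"
  shows "uniform_limit K (\<lambda>j y. det (cjac (f j) y)) (\<lambda>y. det (cjac g y)) sequentially"
proof -
  have g: "holomorphic_map_on g S"
    using holomorphic_limit(1)[OF f \<open>open S\<close> lim] .
  have entry: "uniform_limit K (\<lambda>j y. cjac (f j) y $ a $ b) (\<lambda>y. cjac g y $ a $ b) sequentially"
    and bdd: "bounded ((\<lambda>y. cjac g y $ a $ b) ` K)" for a b
  proof -
    have "(\<lambda>j. cjac (f j) x *v axis b 1) \<longlonglongrightarrow> cjac g x *v axis b 1" if "x \<in> S" for x
      using holomorphic_limit(2)[OF f \<open>open S\<close> lim that]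
      unfolding matrix_vector_mult_def by (intro vec_tendstoI) (auto intro!: tendsto_intros)
    then have *: "uniform_limit K (\<lambda>j y. cjac (f j) y *v axis b 1) (\<lambda>y. cjac g y *v axis b 1) sequentially"
      by (intro loc_bounded_holomorphic_uniform_limit[OF loc_bounded_holomorphic_directional_derivative[OF f] _ K \<open>open S\<close>])
    show "uniform_limit K (\<lambda>j y. cjac (f j) y $ a $ b) (\<lambda>y. cjac g y $ a $ b) sequentially"
      using bounded_linear.uniform_limit[OF bounded_linear_vec_nth *, of a] by (simp only: cjac_entry)
    have "continuous_on K (\<lambda>y. (cjac g y *v axis b 1) $ a)"
      using holomorphic_map_on_imp_continuous_on[OF holomorphic_map_on_directional_derivative[OF g \<open>open S\<close>]]
      by (intro continuous_intros) (rule continuous_on_subset[OF _ K(2)])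
    then show "bounded ((\<lambda>y. cjac g y $ a $ b) ` K)"
      unfolding cjac_entry using K(1) by (intro compact_imp_bounded compact_continuous_image)
  qed
  have "uniform_limit K
      (\<lambda>j y. \<Sum>p | p permutes UNIV. of_int (sign p) * (\<Prod>i\<in>UNIV. cjac (f j) y $ i $ p i))
      (\<lambda>y. \<Sum>p | p permutes UNIV. of_int (sign p) * (\<Prod>i\<in>UNIV. cjac g y $ i $ p i)) sequentially"
    by (intro uniform_limit_sum finite_permutations bounded_linear.uniform_limit[OF bounded_linear_mult_right]
        conjunct1[OF uniform_limit_prod] entry bdd) auto
  then show ?thesis
    unfolding det_def .
qed

lemma has_derivative_ident_mat: "((\<lambda>y. y) has_derivative (*v) (mat 1)) (at x)" for x :: "complex^'n"
  by (rule has_derivative_eq_rhs[OF has_derivative_ident]) (simp add: fun_eq_iff)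

text \<open>On the complex line through \<open>p\<close> and \<open>q\<close> the limit determinant
  is a function of one variable, nonzero at the parameter of \<open>p\<close>. It is either constant
  or a nonconstant limit of zero-free functions, to which Hurwitz's theorem applies.\<close>

lemma hurwitz_det_cjac_ball:
  fixes f :: "nat \<Rightarrow> complex^'n \<Rightarrow> complex^'n"
  assumes f: "loc_bounded_holomorphic f (ball x R)"
    and lim: "\<And>y. y \<in> ball x R \<Longrightarrow> (\<lambda>j. f j y) \<longlonglongrightarrow> g y"
    and ev: "\<forall>\<^sub>F j in sequentially. holomorphic_map_on (f j) (ball x R) \<and> (\<forall>y\<in>ball x R. det (cjac (f j) y) \<noteq> 0)"
    and p: "p \<in> ball x R" "det (cjac g p) \<noteq> 0" and q: "q \<in> ball x R"
  shows "det (cjac g q) \<noteq> 0"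
proof -
  have hid: "holomorphic_map_on (\<lambda>y. y) (ball x R)"
    by (rule holomorphic_map_onI) (rule has_derivative_ident_mat)
  have holg: "holomorphic_map_on g (ball x R)"
    using holomorphic_limit(1)[OF f open_ball lim] .
  obtain N where N: "\<And>j. j \<ge> N \<Longrightarrow> holomorphic_map_on (f j) (ball x R)"
    "\<And>j y. j \<ge> N \<Longrightarrow> y \<in> ball x R \<Longrightarrow> det (cjac (f j) y) \<noteq> 0"
    using ev unfolding eventually_sequentially by blast
  define l where "l = (\<lambda>\<zeta>. p + \<zeta> *s (q - p))"
  define U where "U = l -` ball x R"
  have contl: "continuous_on A l" for A
    unfolding l_def by (intro continuous_intros linear_continuous_on bounded_linear_smult_left)
  have "open U"
    unfolding U_def by (intro open_vimage contl open_ball)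
  \<comment> \<open>As a translated linear preimage of a ball the parameter set is convex, hence
    connected, as Hurwitz's theorem requires.\<close>
  have "U = (\<lambda>\<zeta>. \<zeta> *s (q - p)) -` ball (x - p) R"
    by (auto simp: U_def l_def dist_norm algebra_simps)
  then have "convex U"
    by (simp only: convex_linear_vimage bounded_linear.linear[OF bounded_linear_smult_left] convex_ball)
  \<comment> \<open>The shift by \<open>N\<close> discards the members that may have zeros or fail
    to be holomorphic.\<close>
  define F where "F = (\<lambda>n \<zeta>. det (cjac (f (n + N)) (l \<zeta>)))"
  define G where "G = (\<lambda>\<zeta>. det (cjac g (l \<zeta>)))"
  have "l 0 = p" "l 1 = q" by (simp_all add: l_def)
  then have U01: "0 \<in> U" "1 \<in> U" using p(1) q by (auto simp: U_def)
  have "G 1 \<noteq> 0"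
  proof (cases "G constant_on U")
    case True
    then have "G 1 = G 0" using U01 by (auto simp: constant_on_def)
    then show ?thesis using p(2) \<open>l 0 = p\<close> by (simp add: G_def)
  next
    case False
    show ?thesis
    proof (rule Hurwitz_no_zeros[OF \<open>open U\<close> convex_connected[OF \<open>convex U\<close>] _ _ _ False _ U01(2), of F])
      show "F n holomorphic_on U" for n
        unfolding F_def l_def
        by (intro holomorphic_on_det_cjac_line[OF N(1) open_ball hid open_ball]) (auto simp: U_def l_def)
      show "G holomorphic_on U"
        unfolding G_def l_def
        by (intro holomorphic_on_det_cjac_line[OF holg open_ball hid open_ball]) (auto simp: U_def l_def)
      show "F n \<zeta> \<noteq> 0" if "\<zeta> \<in> U" for n \<zeta>
        using that N(2)[of "n + N" "l \<zeta>"] by (simp add: F_def U_def)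
      show "uniform_limit K F G sequentially" if "compact K" "K \<subseteq> U" for K
      proof -
        have "uniform_limit (l ` K) (\<lambda>j y. det (cjac (f j) y)) (\<lambda>y. det (cjac g y)) sequentially"
          using that contl
          by (intro uniform_limit_det_cjac[OF f lim _ _ open_ball] compact_continuous_image) (auto simp: U_def)
        then have "uniform_limit K (\<lambda>j \<zeta>. det (cjac (f j) (l \<zeta>))) G sequentially"
          unfolding G_def by (rule uniform_limit_compose') auto
        then show ?thesis
          unfolding F_def uniform_limit_iff using sequentially_offset[where k = N] by blast
      qed
    qed
  qed
  then show ?thesis using \<open>l 1 = q\<close> by (simp add: G_def)
qed

text \<open>Injectivity makes the approximating determinants zero-free on small balls, by Osgood's
  theorem, so on such a ball the limit determinant vanishes everywhere or nowhere. Its zero set in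
  \<open>S\<close> and the complement are then both open, and connectedness decides.\<close>

lemma hurwitz_det_cjac:
  fixes f :: "nat \<Rightarrow> complex^'n \<Rightarrow> complex^'n"
  assumes f: "loc_bounded_holomorphic f S" and S: "open S" "connected S"
    and lim: "\<And>y. y \<in> S \<Longrightarrow> (\<lambda>j. f j y) \<longlonglongrightarrow> g y"
    and inj: "\<And>x. x \<in> S \<Longrightarrow> \<exists>R>0. \<forall>\<^sub>F j in sequentially.
      holomorphic_map_on (f j) (ball x R) \<and> inj_on (f j) (ball x R)"
    and p: "p \<in> S" "det (cjac g p) \<noteq> 0" and q: "q \<in> S"
  shows "det (cjac g q) \<noteq> 0"
proof -
  have "\<exists>r>0. ball x r \<subseteq> S \<and> (\<forall>a\<in>ball x r. \<forall>b\<in>ball x r. det (cjac g a) \<noteq> 0 \<longrightarrow> det (cjac g b) \<noteq> 0)"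
    if x: "x \<in> S" for x
  proof -
    obtain R where R: "R > 0" "\<forall>\<^sub>F j in sequentially.
      holomorphic_map_on (f j) (ball x R) \<and> inj_on (f j) (ball x R)"
      using inj[OF x] by blast
    obtain R' where R': "R' > 0" "ball x R' \<subseteq> S"
      using S(1) x open_contains_ball by blast
    define r where "r = min R R'"
    have r: "r > 0" "ball x r \<subseteq> S" "ball x r \<subseteq> ball x R"
      using R(1) R' by (auto simp: r_def)
    have ev: "\<forall>\<^sub>F j in sequentially.
      holomorphic_map_on (f j) (ball x r) \<and> (\<forall>y\<in>ball x r. det (cjac (f j) y) \<noteq> 0)"
      using R(2)
    proof eventually_elim
      case (elim j)
      then have "holomorphic_map_on (f j) (ball x r)" "inj_on (f j) (ball x r)"
        using r(3) holomorphic_map_on_subset inj_on_subset by blast+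
      then show ?case
        using det_cjac_nonzero_if_inj[OF _ open_ball] by blast
    qed
    show ?thesis
      using hurwitz_det_cjac_ball[OF loc_bounded_holomorphic_subset[OF f r(2)] lim ev] r by blast
  qed
  then obtain r where r: "\<And>x. x \<in> S \<Longrightarrow> r x > 0 \<and> ball x (r x) \<subseteq> S \<and>
      (\<forall>a\<in>ball x (r x). \<forall>b\<in>ball x (r x). det (cjac g a) \<noteq> 0 \<longrightarrow> det (cjac g b) \<noteq> 0)"
    by metis
  define A where "A = {x \<in> S. det (cjac g x) \<noteq> 0}"
  have "ball x (r x) \<subseteq> A" if "x \<in> A" for x
    using r[of x] that centre_in_ball[of x "r x"] unfolding A_def by blast
  then have "open A"
    unfolding open_contains_ball using r by (metis (no_types, lifting) A_def mem_Collect_eq)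
  have "ball x (r x) \<subseteq> S - A" if "x \<in> S - A" for x
    using r[of x] that centre_in_ball[of x "r x"] unfolding A_def by blast
  then have "open (S - A)"
    unfolding open_contains_ball using r by (metis DiffD1)
  have "S - A = {}"
    using connectedD[OF S(2) \<open>open A\<close> \<open>open (S - A)\<close>] p by (auto simp: A_def)
  then show ?thesis
    using q by (auto simp: A_def)
qed

section \<open>Squeezing functions of exhausted domains\<close>

text \<open>Montel's theorem: a subsequence converges on a countable dense set, and equicontinuity
  carries the convergence to all other points.\<close>

lemma montel_subsequence:
  fixes f :: "nat \<Rightarrow> complex^'n \<Rightarrow> complex^'m"
  assumes f: "loc_bounded_holomorphic f S" and "open S"
    and M: "\<And>x. x \<in> S \<Longrightarrow> \<forall>\<^sub>F j in sequentially. norm (f j x) \<le> M"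
  obtains k g where "strict_mono k" "\<And>x. x \<in> S \<Longrightarrow> (\<lambda>j. f (k j) x) \<longlonglongrightarrow> g x"
proof -
  obtain Q :: "(complex^'n) set" where Q: "countable Q" "\<And>X. open X \<Longrightarrow> X \<noteq> {} \<Longrightarrow> \<exists>d\<in>Q. d \<in> X"
    using countable_dense_setE by blast
  \<comment> \<open>The bound holds at each point only from some index on, whereas the extraction
    asks for it at all indices. Truncation to 0 changes only finitely many values at each point of
    \<open>S\<close>.\<close>
  define F where "F = (\<lambda>j x. if norm (f j x) \<le> M then f j x else 0)"
  have "norm (F j x) \<le> \<bar>M\<bar>" for j x
    by (auto simp: F_def)
  then obtain k where k: "strict_mono (k::nat\<Rightarrow>nat)" "\<And>x. x \<in> Q \<Longrightarrow> \<exists>l. (\<lambda>n. F (k n) x) \<longlonglongrightarrow> l"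
    using function_convergent_subsequence[OF Q(1), of F "\<bar>M\<bar>"] by metis
  have Qlim: "Cauchy (\<lambda>n. f (k n) x)" if x: "x \<in> Q" "x \<in> S" for x
  proof -
    obtain l where l: "(\<lambda>n. F (k n) x) \<longlonglongrightarrow> l"
      using k(2)[OF x(1)] by blast
    have "\<forall>\<^sub>F j in sequentially. F (k j) x = f (k j) x"
      using eventually_subseq[OF k(1) M[OF x(2)]] by eventually_elim (simp add: F_def)
    then have "(\<lambda>n. f (k n) x) \<longlonglongrightarrow> l"
      using l by (rule Lim_transform_eventually[rotated])
    then show ?thesis by (rule LIMSEQ_imp_Cauchy)
  qed
  have fk: "loc_bounded_holomorphic (\<lambda>j. f (k j)) S"
    using loc_bounded_holomorphic_subseq[OF f k(1)] .
  have "convergent (\<lambda>j. f (k j) x)" if x: "x \<in> S" for x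
  proof (rule Cauchy_convergent, rule CauchyI)
    fix e :: real assume "e > 0"
    obtain r L where r: "r > 0" "L \<ge> 0" and ev: "\<forall>\<^sub>F j in sequentially.
        \<forall>y\<in>ball x r. \<forall>y'\<in>ball x r. norm (f (k j) y' - f (k j) y) \<le> L * norm (y' - y)"
      using loc_bounded_holomorphic_lipschitz[OF fk x] .
    define s where "s = min r (e / (3 * (L + 1)))"
    have s: "s > 0" using r \<open>e > 0\<close> by (simp add: s_def)
    have "(L + 1) * s \<le> (L + 1) * (e / (3 * (L + 1)))"
      using r(2) by (intro mult_left_mono) (auto simp: s_def)
    also have "\<dots> = e / 3" using r(2) by (simp add: field_simps)
    finally have Ls: "L * s < e / 3" using s by (simp add: algebra_simps)
    have "x \<in> ball x s \<inter> S" using s x by simp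
    then obtain q where q: "q \<in> Q" "q \<in> ball x s" "q \<in> S"
      using Q(2)[of "ball x s \<inter> S"] \<open>open S\<close> by blast
    obtain N where N: "\<And>m n. m \<ge> N \<Longrightarrow> n \<ge> N \<Longrightarrow> norm (f (k m) q - f (k n) q) < e / 3"
      using CauchyD[OF Qlim[OF q(1,3)], of "e / 3"] \<open>e > 0\<close> by auto
    obtain N' where N': "\<And>j y y'. j \<ge> N' \<Longrightarrow> y \<in> ball x r \<Longrightarrow> y' \<in> ball x r \<Longrightarrow>
        norm (f (k j) y' - f (k j) y) \<le> L * norm (y' - y)"
      using ev unfolding eventually_sequentially by blast
    have close: "norm (f (k j) x - f (k j) q) < e / 3" if "j \<ge> N'" for j
    proof -
      have "norm (f (k j) x - f (k j) q) \<le> L * norm (x - q)"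
        using q(2) r(1) by (intro N'[OF that]) (auto simp: s_def)
      also have "\<dots> \<le> L * s"
        using q(2) r(2) by (intro mult_left_mono) (auto simp: dist_norm)
      finally show ?thesis using Ls by simp
    qed
    have "norm (f (k m) x - f (k n) x) < e" if "m \<ge> max N N'" "n \<ge> max N N'" for m n
      using N[of m n] close[of m] close[of n] that
        dist_triangle[of "f (k m) x" "f (k n) x" "f (k m) q"]
        dist_triangle[of "f (k m) q" "f (k n) x" "f (k n) q"]
      by (simp add: dist_norm norm_minus_commute)
    then show "\<exists>N. \<forall>m\<ge>N. \<forall>n\<ge>N. norm (f (k m) x - f (k n) x) < e"
      by blast
  qed
  then have "(\<lambda>j. f (k j) x) \<longlonglongrightarrow> lim (\<lambda>j. f (k j) x)" if "x \<in> S" for x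
    using that convergent_LIMSEQ_iff by blast
  then show ?thesis
    by (rule that[OF k(1)])
qed

text \<open>The frontier of the open set \<open>f j ` ball x r\<close> is \<open>f j ` sphere x r\<close>, which stays away
  from \<open>g x\<close>, whereas \<open>f j x\<close> approaches \<open>g x\<close>.\<close>

lemma eventually_limit_value_in_image_ball:
  fixes f :: "nat \<Rightarrow> 'a::euclidean_space \<Rightarrow> 'a"
  assumes ul: "uniform_limit (cball x r) f g sequentially"
    and inj: "\<forall>\<^sub>F j in sequentially. continuous_on (cball x r) (f j) \<and> inj_on (f j) (ball x r)"
    and g: "continuous_on (cball x r) g" and "r > 0"
    and ne: "\<And>p. dist x p = r \<Longrightarrow> g p \<noteq> g x"
  shows "\<forall>\<^sub>F j in sequentially. g x \<in> f j ` ball x r"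
proof -
  have "compact (g ` sphere x r)"
    using g by (intro compact_continuous_image) (auto intro: continuous_on_subset)
  moreover have "g x \<notin> g ` sphere x r"
    using ne by force
  ultimately obtain d where d: "d > 0" "\<And>p. p \<in> sphere x r \<Longrightarrow> d \<le> dist (g x) (g p)"
    using separate_point_closed[of "g ` sphere x r" "g x"] compact_imp_closed by (metis imageI)
  have "\<forall>\<^sub>F j in sequentially. \<forall>p\<in>cball x r. dist (f j p) (g p) < d / 2"
    using uniform_limitD[OF ul, of "d / 2"] d(1) by simp
  with inj show ?thesis
  proof eventually_elim
    case (elim j)
    let ?V = "f j ` ball x r"
    have "open ?V"
      using elim(1) by (intro invariance_of_domain) (auto intro: continuous_on_subset)
    have far: "f j p \<notin> ball (g x) (d / 2)" if "p \<in> sphere x r" for p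
      using d(2)[OF that] elim(2)[rule_format, of p] that
        dist_triangle[of "g x" "g p" "f j p"] by auto
    have "closure ?V \<subseteq> f j ` cball x r"
      using elim(1) by (intro closure_minimal compact_imp_closed compact_continuous_image) auto
    moreover have "cball x r = ball x r \<union> sphere x r"
      by auto
    ultimately have "closure ?V \<subseteq> ?V \<union> f j ` sphere x r"
      by (metis image_Un)
    then have "frontier ?V \<subseteq> f j ` sphere x r"
      using \<open>open ?V\<close> by (auto simp: frontier_def interior_open)
    then have "ball (g x) (d / 2) \<inter> frontier ?V = {}"
      using far by blast
    moreover have "f j x \<in> ball (g x) (d / 2) \<inter> ?V"
      using elim(2)[rule_format, of x] \<open>r > 0\<close> by (auto simp: dist_commute)
    ultimately have "ball (g x) (d / 2) \<subseteq> ?V"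
      using connected_Int_frontier[of "ball (g x) (d / 2)" ?V] by fastforce
    then show ?case using d(1) by auto
  qed
qed

section \<open>Values of nondegenerate limits\<close>

text \<open>The derivative stretches every vector by a factor of at least \<open>B\<close>, and near
  \<open>x\<close> the remainder consumes at most half of this.\<close>

lemma isolated_value_if_det_cjac_nonzero:
  fixes g :: "complex^'n \<Rightarrow> complex^'n"
  assumes g: "holomorphic_map_on g S" "open S" "x \<in> S" and det: "det (cjac g x) \<noteq> 0"
  obtains d where "d > 0" "\<And>p. 0 < dist x p \<Longrightarrow> dist x p < d \<Longrightarrow> g p \<noteq> g x"
proof -
  have "inj ((*v) (cjac g x))"
    using det by (simp add: invertible_det_nz[symmetric] invertible_left_inverse matrix_left_invertible_injective)
  then obtain B where B: "B > 0" "\<And>v. B * norm v \<le> norm (cjac g x *v v)"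
    using linear_inj_bounded_below_pos bounded_linear.linear[OF bounded_linear_matrix_vector_mult] by blast
  obtain d where d: "d > 0" "\<And>y. norm (y - x) < d \<Longrightarrow>
      norm (g y - g x - cjac g x *v (y - x)) \<le> B / 2 * norm (y - x)"
    using has_derivative_cjac[OF g] B(1) unfolding has_derivative_at_alt by (meson half_gt_zero)
  have "g p \<noteq> g x" if p: "0 < dist x p" "dist x p < d" for p
  proof
    assume "g p = g x"
    then have "B * norm (p - x) \<le> B / 2 * norm (p - x)"
      using d(2)[of p] B(2)[of "p - x"] p by (simp add: dist_norm norm_minus_commute)
    then show False
      using B(1) p by (simp add: dist_norm norm_minus_commute)
  qed
  with d(1) that show ?thesis by blast
qed

text \<open>The nonzero Jacobian isolates the value \<open>g x\<close> on a small closed ball, which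
  replaces a degree argument. The result serves twice: to put the values of \<open>h\<close> into
  \<Omega> and to prove \<open>g\<close> injective.\<close>

lemma limit_value_in_image:
  fixes f :: "nat \<Rightarrow> complex^'n \<Rightarrow> complex^'n"
  assumes f: "loc_bounded_holomorphic f S" and S: "open S"
    and lim: "\<And>y. y \<in> S \<Longrightarrow> (\<lambda>j. f j y) \<longlonglongrightarrow> g y"
    and inj: "\<And>x. x \<in> S \<Longrightarrow> \<exists>R>0. \<forall>\<^sub>F j in sequentially. holomorphic_map_on (f j) (ball x R) \<and> inj_on (f j) (ball x R)"
    and x: "x \<in> S" and det: "det (cjac g x) \<noteq> 0" and "e > 0"
  shows "\<forall>\<^sub>F j in sequentially. g x \<in> f j ` ball x e"
proof -
  have g: "holomorphic_map_on g S"
    using holomorphic_limit(1)[OF f S lim] .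
  obtain d where d: "d > 0" "\<And>p. 0 < dist x p \<Longrightarrow> dist x p < d \<Longrightarrow> g p \<noteq> g x"
    by (rule isolated_value_if_det_cjac_nonzero[OF g S x det]) (rule that)
  obtain R where R: "R > 0" "\<forall>\<^sub>F j in sequentially. holomorphic_map_on (f j) (ball x R) \<and> inj_on (f j) (ball x R)"
    using inj[OF x] by blast
  obtain R' where R': "R' > 0" "ball x R' \<subseteq> S"
    using S x open_contains_ball by blast
  define r where "r = min (min d e) (min R R') / 2"
  have r: "r > 0" "r < d" "r < e" "r < R" "r < R'"
    using d R R' \<open>e > 0\<close> by (auto simp: r_def)
  have sub: "cball x r \<subseteq> S" "cball x r \<subseteq> ball x R" "ball x r \<subseteq> cball x r"
    using r R'(2) by (auto simp: subset_iff)
  have "\<forall>\<^sub>F j in sequentially. g x \<in> f j ` ball x r"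
  proof (rule eventually_limit_value_in_image_ball[OF _ _ _ r(1)])
    show "uniform_limit (cball x r) f g sequentially"
      using loc_bounded_holomorphic_uniform_limit[OF f lim _ sub(1) S] by simp
    show "continuous_on (cball x r) g"
      using holomorphic_map_on_imp_continuous_on[OF g] sub(1) by (rule continuous_on_subset)
    show "g p \<noteq> g x" if "dist x p = r" for p
      using d(2)[of p] r that by simp
    show "\<forall>\<^sub>F j in sequentially. continuous_on (cball x r) (f j) \<and> inj_on (f j) (ball x r)"
      using R(2)
    proof eventually_elim
      case (elim j)
      then show ?case
        using sub holomorphic_map_on_imp_continuous_on continuous_on_subset inj_on_subset by (metis subset_trans)
    qed
  qed
  then show ?thesis
  proof eventually_elim
    case (elim j)
    then show ?case using r(3) by force
  qed
qed

section \<open>The suprema in the squeezing function\<close>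

lemma inj_holomorphic_image_open:
  fixes f :: "complex^'n \<Rightarrow> complex^'n"
  assumes "inj_holomorphic_map f D E" "open D"
  shows "open (f ` D)"
  using assms unfolding inj_holomorphic_map_def
  by (intro invariance_of_domain holomorphic_map_on_imp_continuous_on) auto

text \<open>These facts make the \<open>Sup\<close> in \<open>squeezing_radius\<close> a genuine
  supremum. The bound holds because a ball contained in the unit ball about the same centre has
  radius at most 1.\<close>

lemma squeezing_radius_set:
  fixes f :: "complex^'n \<Rightarrow> complex^'n"
  assumes f: "inj_holomorphic_map f D (ball 0 1)" and D: "open D" and z: "z \<in> D" "f z = 0"
  shows "{r. r > 0 \<and> ball 0 r \<subseteq> f ` D} \<noteq> {}"
    and "r > 0 \<Longrightarrow> ball 0 r \<subseteq> f ` D \<Longrightarrow> r \<le> 1"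
    and "bdd_above {r. r > 0 \<and> ball 0 r \<subseteq> f ` D}"
proof -
  have "0 \<in> f ` D" using z by force
  then show "{r. r > 0 \<and> ball 0 r \<subseteq> f ` D} \<noteq> {}"
    using inj_holomorphic_image_open[OF f D] open_contains_ball by blast
  show *: "r \<le> 1" if "r > 0" "ball 0 r \<subseteq> f ` D" for r
  proof -
    have "ball (0::complex^'n) r \<subseteq> ball 0 1"
      using f that(2) unfolding inj_holomorphic_map_def by blast
    then show ?thesis using that(1) by (simp add: ball_subset_ball_iff)
  qed
  show "bdd_above {r. r > 0 \<and> ball 0 r \<subseteq> f ` D}"
    using * by (intro bdd_aboveI[of _ 1]) auto
qed

text \<open>Both suprema are taken over sets bounded by 1, so a single admissible map gives a lower
  bound.\<close>

lemma squeezing_function_ge: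
  fixes f :: "complex^'n \<Rightarrow> complex^'n"
  assumes f: "inj_holomorphic_map f D (ball 0 1)" and D: "open D" and z: "z \<in> D" "f z = 0"
    and r: "r > 0" "ball 0 r \<subseteq> f ` D"
  shows "r \<le> squeezing_function D z"
proof -
  have "r \<le> squeezing_radius D f"
    unfolding squeezing_radius_def using squeezing_radius_set(3)[OF f D z] r by (intro cSup_upper) auto
  also have "squeezing_radius D f \<le> squeezing_function D z"
    unfolding squeezing_function_def
  proof (rule cSup_upper)
    show "bdd_above {squeezing_radius D f |f. inj_holomorphic_map f D (ball 0 1) \<and> f z = 0}"
    proof (rule bdd_aboveI)
      fix s assume "s \<in> {squeezing_radius D f |f. inj_holomorphic_map f D (ball 0 1) \<and> f z = 0}"
      then obtain h where h: "s = squeezing_radius D h" "inj_holomorphic_map h D (ball 0 1)" "h z = 0"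
        by blast
      show "s \<le> 1"
        unfolding h(1) squeezing_radius_def
        using squeezing_radius_set[OF h(2) D z(1) h(3)] by (intro cSup_least) auto
    qed
  qed (use f z in blast)
  finally show ?thesis .
qed

text \<open>The strict inequality yields a suitable map whether or not the supremum is attained.
  This presupposes some admissible map, and a translation followed by a scaling provides
  one.\<close>

lemma squeezing_function_gtE:
  fixes D :: "(complex^'n) set"
  assumes D: "open D" "bounded D" and z: "z \<in> D" and "\<rho> < squeezing_function D z"
  obtains f :: "complex^'n \<Rightarrow> complex^'n"
    where "inj_holomorphic_map f D (ball 0 1)" "f z = 0" "ball 0 \<rho> \<subseteq> f ` D"
proof -
  let ?A = "{squeezing_radius D f |f. inj_holomorphic_map f D (ball 0 1) \<and> f z = 0}"
  obtain B where B: "B > 0" "\<And>x. x \<in> D \<Longrightarrow> norm x \<le> B"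
    using D(2) bounded_pos by metis
  \<comment> \<open>Points of \<open>D\<close> are at distance at most \<open>2 * B\<close> from
    \<open>z\<close>, so this factor brings \<open>D\<close> into the closed ball of radius
    2/3.\<close>
  define c where "c = complex_of_real (1 / (3 * B))"
  define \<phi> where "\<phi> = (\<lambda>x. c *s (x - z))"
  have "c \<noteq> 0" using B by (simp add: c_def)
  have "inj_holomorphic_map \<phi> D (ball 0 1)"
    unfolding inj_holomorphic_map_def
  proof (intro conjI)
    show "holomorphic_map_on \<phi> D"
    proof (rule holomorphic_map_onI)
      fix x
      have "((\<lambda>x. x - z) has_derivative (\<lambda>h. h)) (at x)"
        by (auto intro!: derivative_eq_intros)
      from bounded_linear.has_derivative[OF bounded_linear_matrix_vector_mult[of "mat c"] this]
      have "((\<lambda>x. mat c *v (x - z)) has_derivative (*v) (mat c)) (at x)" .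
      then show "(\<phi> has_derivative (*v) (mat c)) (at x)"
        by (simp only: \<phi>_def mat_vector_mult[symmetric])
    qed
    show "inj_on \<phi> D"
      using \<open>c \<noteq> 0\<close> by (auto simp: \<phi>_def inj_on_def vec_eq_iff)
    show "\<phi> ` D \<subseteq> ball 0 1"
    proof
      fix y assume "y \<in> \<phi> ` D"
      then obtain x where x: "x \<in> D" "y = \<phi> x" by blast
      have "norm (x - z) \<le> 2 * B"
        using B(2)[OF x(1)] B(2)[OF z] norm_triangle_ineq4[of x z] by simp
      then have "norm y \<le> 1 / (3 * B) * (2 * B)"
        unfolding x(2) \<phi>_def norm_vector_smult c_def norm_of_real using B(1) by (intro mult_mono) auto
      then show "y \<in> ball 0 1" using B(1) by simp
    qed
  qed
  moreover have "\<phi> z = 0" by (simp add: \<phi>_def vec_eq_iff)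
  ultimately have "?A \<noteq> {}" by blast
  then obtain f where f: "inj_holomorphic_map f D (ball 0 1)" "f z = 0" "\<rho> < squeezing_radius D f"
    using assms(4) unfolding squeezing_function_def by (blast elim: less_cSupE)
  then obtain r where r: "r > \<rho>" "ball 0 r \<subseteq> f ` D"
    using less_cSupE[OF f(3)[unfolded squeezing_radius_def] squeezing_radius_set(1)[OF f(1) D(1) z f(2)]] by blast
  have "ball 0 \<rho> \<subseteq> f ` D"
    using r by (meson less_imp_le subset_ball subset_trans)
  with f(1,2) show ?thesis by (rule that)
qed

section \<open>The approximating pairs and their limits\<close>

text \<open>\<open>G\<close> is \<phi> after the inverse of \<open>f\<close>, on the image of
  \<open>f\<close>, and \<open>H\<close> is \<open>f\<close> after the inverse of \<phi>, on the
  image of \<phi>. Choosing \<phi> to vanish at the preimage of \<open>z\<close> under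
  \<open>f\<close> gives \<open>G z = 0\<close>.\<close>

lemma exhausting_maps:
  fixes \<Omega> D K :: "(complex^'n) set"
  assumes ex: "exhausted_by \<Omega> D" and D: "open D" "bounded D"
    and sq: "\<And>w. w \<in> D \<Longrightarrow> \<rho> < squeezing_function D w"
    and K: "compact K" "K \<subseteq> \<Omega>" "z \<in> K"
  shows "\<exists>(G :: complex^'n \<Rightarrow> complex^'n) H T V. open T \<and> K \<subseteq> T \<and> T \<subseteq> \<Omega> \<and> open V \<and> ball 0 \<rho> \<subseteq> V \<and>
    holomorphic_map_on G T \<and> holomorphic_map_on H V \<and> G ` T \<subseteq> ball 0 1 \<and> H ` V \<subseteq> \<Omega> \<and>
    (\<forall>x\<in>T. H (G x) = x) \<and> (\<forall>y\<in>V. G (H y) = y) \<and> G z = 0"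
proof -
  obtain f where f: "inj_holomorphic_map f D \<Omega>" "K \<subseteq> f ` D"
    using ex K unfolding exhausted_by_def by blast
  then obtain w where w: "w \<in> D" "f w = z"
    using K(3) by blast
  obtain \<phi> :: "complex^'n \<Rightarrow> complex^'n"
    where \<phi>: "inj_holomorphic_map \<phi> D (ball 0 1)" "\<phi> w = 0" "ball 0 \<rho> \<subseteq> \<phi> ` D"
    using squeezing_function_gtE[OF D w(1) sq[OF w(1)]] .
  have hf: "holomorphic_map_on f D" "inj_on f D" "f ` D \<subseteq> \<Omega>"
    and h\<phi>: "holomorphic_map_on \<phi> D" "inj_on \<phi> D" "\<phi> ` D \<subseteq> ball 0 1"
    using f \<phi> by (auto simp: inj_holomorphic_map_def)
  have op: "open (f ` D)" "open (\<phi> ` D)"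
    by (rule inj_holomorphic_image_open[OF f(1) D(1)] inj_holomorphic_image_open[OF \<phi>(1) D(1)])+
  have inv: "inv_into D f ` (f ` D) \<subseteq> D" "inv_into D \<phi> ` (\<phi> ` D) \<subseteq> D"
    by (auto intro: inv_into_into)
  show ?thesis
  proof (intro exI conjI ballI)
    show "holomorphic_map_on (\<phi> \<circ> inv_into D f) (f ` D)"
      using holomorphic_map_on_compose(1)[OF holomorphic_map_on_inv_into[OF hf(1) D(1) hf(2)] h\<phi>(1) op(1) D(1) inv(1)] .
    show "holomorphic_map_on (f \<circ> inv_into D \<phi>) (\<phi> ` D)"
      using holomorphic_map_on_compose(1)[OF holomorphic_map_on_inv_into[OF h\<phi>(1) D(1) h\<phi>(2)] hf(1) op(2) D(1) inv(2)] .
    show "(\<phi> \<circ> inv_into D f) ` (f ` D) \<subseteq> ball 0 1" "(f \<circ> inv_into D \<phi>) ` (\<phi> ` D) \<subseteq> \<Omega>"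
      using inv hf(3) h\<phi>(3) unfolding image_comp[symmetric] by blast+
    show "(\<phi> \<circ> inv_into D f) z = 0"
      using hf(2) w \<phi>(2) by (auto simp: w(2)[symmetric])
    show "open (f ` D)" "open (\<phi> ` D)" "ball 0 \<rho> \<subseteq> \<phi> ` D" "K \<subseteq> f ` D" "f ` D \<subseteq> \<Omega>"
      by (fact op \<phi>(3) f(2) hf(3))+
    show "(f \<circ> inv_into D \<phi>) ((\<phi> \<circ> inv_into D f) x) = x" if "x \<in> f ` D" for x
      using that h\<phi>(2) by (simp add: inv_into_into f_inv_into_f)
    show "(\<phi> \<circ> inv_into D f) ((f \<circ> inv_into D \<phi>) y) = y" if "y \<in> \<phi> ` D" for y
      using that hf(2) by (simp add: inv_into_into f_inv_into_f)
  qed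
qed

theorem theorem1p2:
  fixes \<Omega> D :: "(complex^'n) set"
  assumes "is_domain \<Omega>" and "bounded \<Omega>"
    and "homogenous_regular D"
    and "exhausted_by \<Omega> D"
  shows "homogenous_regular \<Omega>"
proof -
  have \<Omega>: "open \<Omega>" "connected \<Omega>"
    using assms(1) by (auto simp: is_domain_def)
  obtain c where c: "c > 0" "\<And>w. w \<in> D \<Longrightarrow> c \<le> squeezing_function D w" and D: "open D" "bounded D"
    using assms(3) by (auto simp: homogenous_regular_def is_domain_def)
  \<comment> \<open>A value strictly below \<open>c\<close> gives every point of \<open>D\<close> an
    admissible map whose image contains \<open>ball 0 \<rho>\<close>.\<close>
  define \<rho> where "\<rho> = c / 2"
  have \<rho>: "\<rho> > 0" "\<And>w. w \<in> D \<Longrightarrow> \<rho> < squeezing_function D w"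
    using c by (fastforce simp: \<rho>_def)+
  have "\<rho> \<le> squeezing_function \<Omega> z" if z: "z \<in> \<Omega>" for z
  proof -
    obtain C :: "nat \<Rightarrow> (complex^'n) set" where C: "\<And>n. compact (C n)" "\<And>n. C n \<subseteq> \<Omega>"
      "\<And>K. compact K \<Longrightarrow> K \<subseteq> \<Omega> \<Longrightarrow> \<exists>N. \<forall>n\<ge>N. K \<subseteq> C n"
      using open_Union_compact_subsets[OF \<Omega>(1)] by metis
    define P where "P = (\<lambda>n G H T V. open T \<and> insert z (C n) \<subseteq> T \<and> T \<subseteq> \<Omega> \<and> open V \<and> ball 0 \<rho> \<subseteq> V \<and>
      holomorphic_map_on G T \<and> holomorphic_map_on H V \<and> G ` T \<subseteq> ball 0 1 \<and> H ` V \<subseteq> \<Omega> \<and>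
      (\<forall>x\<in>T. H (G x) = x) \<and> (\<forall>y\<in>V. G (H y) = y) \<and> G z = (0::complex^'n))"
    have "\<exists>G H T V. P n G H T V" for n
      unfolding P_def by (rule exhausting_maps[OF assms(4) D \<rho>(2)]) (use C(1,2) z in auto)
    then obtain G0 H0 T0 V0 where "\<And>n. P n (G0 n) (H0 n) (T0 n) (V0 n)"
      by metis
    then have P0: "open (T0 n)" "insert z (C n) \<subseteq> T0 n" "T0 n \<subseteq> \<Omega>" "open (V0 n)" "ball 0 \<rho> \<subseteq> V0 n"
      "holomorphic_map_on (G0 n) (T0 n)" "holomorphic_map_on (H0 n) (V0 n)"
      "G0 n ` T0 n \<subseteq> ball 0 1" "H0 n ` V0 n \<subseteq> \<Omega>"
      "\<And>x. x \<in> T0 n \<Longrightarrow> H0 n (G0 n x) = x" "\<And>y. y \<in> V0 n \<Longrightarrow> G0 n (H0 n y) = y" "G0 n z = 0" for n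
      unfolding P_def by blast+
    \<comment> \<open>Boundedness of \<Omega> makes the maps \<open>H0 n\<close> uniformly
      bounded.\<close>
    obtain B where B: "\<And>x. x \<in> \<Omega> \<Longrightarrow> norm x \<le> B"
      using assms(2) bounded_iff by metis
    have cover: "\<exists>R>0. ball x R \<subseteq> \<Omega> \<and> (\<forall>\<^sub>F n in sequentially. ball x R \<subseteq> T0 n)" if x: "x \<in> \<Omega>" for x
    proof -
      obtain R where R: "R > 0" "cball x R \<subseteq> \<Omega>"
        using \<Omega>(1) x open_contains_cball by blast
      obtain N where "\<And>n. n \<ge> N \<Longrightarrow> cball x R \<subseteq> C n"
        using C(3)[OF compact_cball R(2)] by blast
      then have "\<forall>\<^sub>F n in sequentially. ball x R \<subseteq> T0 n"
        unfolding eventually_sequentially using P0(2) ball_subset_cball by (meson insert_subset subset_trans)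
      with R show ?thesis using ball_subset_cball by blast
    qed
    have locG0: "loc_bounded_holomorphic G0 \<Omega>"
      unfolding loc_bounded_holomorphic_def
    proof
      fix x assume "x \<in> \<Omega>"
      then obtain R where R: "R > 0" "\<forall>\<^sub>F n in sequentially. ball x R \<subseteq> T0 n"
        using cover by blast
      from R(2) have "\<forall>\<^sub>F n in sequentially. holomorphic_map_on (G0 n) (ball x R) \<and> (\<forall>y\<in>ball x R. norm (G0 n y) \<le> 1)"
      proof eventually_elim
        case (elim n)
        then show ?case
          using holomorphic_map_on_subset[OF P0(6) elim] P0(8)[of n] by (force simp: image_subset_iff)
      qed
      with R(1) show "\<exists>R>0. \<exists>M. \<forall>\<^sub>F n in sequentially.
          holomorphic_map_on (G0 n) (ball x R) \<and> (\<forall>y\<in>ball x R. norm (G0 n y) \<le> M)"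
        by blast
    qed
    have locH0: "loc_bounded_holomorphic H0 (ball 0 \<rho>)"
      unfolding loc_bounded_holomorphic_def
    proof
      fix y :: "complex^'n" assume "y \<in> ball 0 \<rho>"
      then obtain R where R: "R > 0" "ball y R \<subseteq> ball 0 \<rho>"
        using open_contains_ball by (metis open_ball)
      have "holomorphic_map_on (H0 n) (ball y R) \<and> (\<forall>x\<in>ball y R. norm (H0 n x) \<le> B)" for n
        using holomorphic_map_on_subset[OF P0(7)[of n]] R(2) P0(5)[of n] P0(9)[of n] B by (meson image_subset_iff subsetD subset_trans)
      then have "\<forall>\<^sub>F n in sequentially. holomorphic_map_on (H0 n) (ball y R) \<and> (\<forall>x\<in>ball y R. norm (H0 n x) \<le> B)"
        by simp
      with R(1) show "\<exists>R>0. \<exists>M. \<forall>\<^sub>F n in sequentially.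
          holomorphic_map_on (H0 n) (ball y R) \<and> (\<forall>x\<in>ball y R. norm (H0 n x) \<le> M)"
        by blast
    qed
    have G0_bound: "\<forall>\<^sub>F n in sequentially. norm (G0 n x) \<le> 1" if x: "x \<in> \<Omega>" for x
    proof -
      obtain R where R: "R > 0" "\<forall>\<^sub>F n in sequentially. ball x R \<subseteq> T0 n"
        using cover[OF x] by blast
      from R(2) show ?thesis
      proof eventually_elim
        case (elim n)
        then have "x \<in> T0 n" using R(1) by auto
        then have "G0 n x \<in> ball 0 1" using P0(8) by blast
        then show ?case by simp
      qed
    qed
    obtain k g where k: "strict_mono k" and limg0: "\<And>x. x \<in> \<Omega> \<Longrightarrow> (\<lambda>n. G0 (k n) x) \<longlonglongrightarrow> g x"
      using montel_subsequence[OF locG0 \<Omega>(1) G0_bound] by metis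
    have "\<forall>\<^sub>F n in sequentially. norm (H0 (k n) y) \<le> B" if "y \<in> ball 0 \<rho>" for y
      using that P0(5,9) B by (intro always_eventually) blast
    \<comment> \<open>The second extraction runs along the first, so that both families converge
      together.\<close>
    then obtain k' h where k': "strict_mono k'" and limh0: "\<And>y. y \<in> ball 0 \<rho> \<Longrightarrow> (\<lambda>n. H0 (k (k' n)) y) \<longlonglongrightarrow> h y"
      using montel_subsequence[OF loc_bounded_holomorphic_subseq[OF locH0 k] open_ball] by metis
    define s where "s = k \<circ> k'"
    have s: "strict_mono s"
      unfolding s_def using k k' by (rule strict_mono_o)
    define G where "G = (\<lambda>n. G0 (s n))"
    define H where "H = (\<lambda>n. H0 (s n))"
    define T where "T = (\<lambda>n. T0 (s n))"
    define V where "V = (\<lambda>n. V0 (s n))"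
    note defs = G_def H_def T_def V_def
    have op: "open (T n)" "open (V n)" and TV: "z \<in> T n" "ball 0 \<rho> \<subseteq> V n"
      and hol: "holomorphic_map_on (G n) (T n)" "holomorphic_map_on (H n) (V n)"
      and im: "G n ` T n \<subseteq> ball 0 1" "H n ` V n \<subseteq> \<Omega>"
      and inv: "\<And>x. x \<in> T n \<Longrightarrow> H n (G n x) = x" "\<And>y. y \<in> V n \<Longrightarrow> G n (H n y) = y" and G0z: "G n z = 0" for n
      unfolding defs by (fact P0 | use P0(2) in blast)+
    have cover: "\<exists>R>0. ball x R \<subseteq> \<Omega> \<and> (\<forall>\<^sub>F n in sequentially. ball x R \<subseteq> T n)" if "x \<in> \<Omega>" for x
      using cover[OF that] eventually_subseq[OF s] unfolding T_def by blast
    have locG: "loc_bounded_holomorphic G \<Omega>" and locH: "loc_bounded_holomorphic H (ball 0 \<rho>)"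
      unfolding G_def H_def by (intro loc_bounded_holomorphic_subseq[OF _ s] locG0 locH0)+
    have limg: "(\<lambda>n. G n x) \<longlonglongrightarrow> g x" if "x \<in> \<Omega>" for x
      using LIMSEQ_subseq_LIMSEQ[OF limg0[OF that] k'] by (simp add: G_def s_def o_def)
    have limh: "(\<lambda>n. H n y) \<longlonglongrightarrow> h y" if "y \<in> ball 0 \<rho>" for y
      using limh0[OF that] by (simp add: H_def s_def)
    have holg: "holomorphic_map_on g \<Omega>"
      using holomorphic_limit(1)[OF locG \<Omega>(1) limg] .
    have holh: "holomorphic_map_on h (ball 0 \<rho>)"
      using holomorphic_limit(1)[OF locH open_ball limh] .
    have contg: "continuous_on \<Omega> g"
      using holg by (rule holomorphic_map_on_imp_continuous_on)
    have gz: "g z = 0"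
      using LIMSEQ_unique[OF limg[OF z]] by (simp add: G0z)
    have mem_ev: "\<forall>\<^sub>F n in sequentially. x \<in> T n" if x: "x \<in> \<Omega>" for x
    proof -
      obtain R where R: "R > 0" "\<forall>\<^sub>F n in sequentially. ball x R \<subseteq> T n"
        using cover[OF x] by blast
      from R(2) show ?thesis by eventually_elim (use R(1) in auto)
    qed
    \<comment> \<open>\<open>h\<close> arises as a limit only on the ball, so \<open>g x\<close>
      must lie there; in the converse identity \<open>h y\<close> must lie in \<Omega>, which is
      established only after Hurwitz's theorem.\<close>
    have hg: "h (g x) = x" if "x \<in> \<Omega>" "g x \<in> ball 0 \<rho>" for x
    proof (rule LIMSEQ_unique)
      show "(\<lambda>n. H n (G n x)) \<longlonglongrightarrow> h (g x)"
        using loc_bounded_holomorphic_tendsto[OF locH that(2) limh[OF that(2)] limg[OF that(1)]] .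
      have "\<forall>\<^sub>F n in sequentially. x = H n (G n x)"
        using mem_ev[OF that(1)] by eventually_elim (simp add: inv)
      then show "(\<lambda>n. H n (G n x)) \<longlonglongrightarrow> x"
        by (rule Lim_transform_eventually[OF tendsto_const])
    qed
    have gh: "g (h y) = y" if "y \<in> ball 0 \<rho>" "h y \<in> \<Omega>" for y
    proof (rule LIMSEQ_unique)
      show "(\<lambda>n. G n (H n y)) \<longlonglongrightarrow> g (h y)"
        using loc_bounded_holomorphic_tendsto[OF locG that(2) limg[OF that(2)] limh[OF that(1)]] .
      have "G n (H n y) = y" for n
        using inv(2) TV(2) that(1) by blast
      then show "(\<lambda>n. G n (H n y)) \<longlonglongrightarrow> y"
        by simp
    qed
    have "det (cjac h 0) * det (cjac g z) = 1"
    proof -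
      define W where "W = \<Omega> \<inter> g -` ball 0 \<rho>"
      have W: "open W" "z \<in> W" "W \<subseteq> \<Omega>" "g ` W \<subseteq> ball 0 \<rho>"
        unfolding W_def using continuous_open_preimage[OF contg \<Omega>(1) open_ball] z gz \<rho>(1) by auto
      have comp: "cjac (h \<circ> g) z = cjac h 0 ** cjac g z"
        using holomorphic_map_on_compose(2)[OF holomorphic_map_on_subset[OF holg W(3)] holh W(1) open_ball W(4,2)] gz by simp
      have "((h \<circ> g) has_derivative (*v) (mat 1)) (at z)"
      proof (rule has_derivative_transform_within_open[OF has_derivative_ident_mat W(1,2)])
        show "x = (h \<circ> g) x" if "x \<in> W" for x
          using that hg by (simp add: W_def)
      qed
      then have "cjac h 0 ** cjac g z = mat 1"
        using comp cjac_eqI by metis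
      then show ?thesis
        by (metis det_I det_mul)
    qed
    then have det0: "det (cjac g z) \<noteq> 0" "det (cjac h 0) \<noteq> 0"
      by auto
    have injG: "inj_on (G n) (T n)" and injH: "inj_on (H n) (V n)" for n
      using inv by (metis inj_onI)+
    have locinjG: "\<exists>R>0. \<forall>\<^sub>F n in sequentially. holomorphic_map_on (G n) (ball x R) \<and> inj_on (G n) (ball x R)" if x: "x \<in> \<Omega>" for x
    proof -
      obtain R where R: "R > 0" "\<forall>\<^sub>F n in sequentially. ball x R \<subseteq> T n"
        using cover[OF x] by blast
      from R(2) have "\<forall>\<^sub>F n in sequentially. holomorphic_map_on (G n) (ball x R) \<and> inj_on (G n) (ball x R)"
      proof eventually_elim
        case (elim n)
        then show ?case
          using holomorphic_map_on_subset[OF hol(1)] inj_on_subset[OF injG] by blast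
      qed
      with R(1) show ?thesis by blast
    qed
    have locinjH: "\<exists>R>0. \<forall>\<^sub>F n in sequentially. holomorphic_map_on (H n) (ball y R) \<and> inj_on (H n) (ball y R)" if y: "y \<in> ball 0 \<rho>" for y
    proof -
      obtain R where R: "R > 0" "ball y R \<subseteq> ball 0 \<rho>"
        using y open_contains_ball by (metis open_ball)
      then have sub: "ball y R \<subseteq> V n" for n
        using TV(2) by blast
      have "holomorphic_map_on (H n) (ball y R) \<and> inj_on (H n) (ball y R)" for n
        using holomorphic_map_on_subset[OF hol(2) sub] inj_on_subset[OF injH sub] by blast
      with R(1) show ?thesis by auto
    qed
    have h0: "0 \<in> ball (0::complex^'n) \<rho>"
      using \<rho>(1) by simp
    have detg: "det (cjac g x) \<noteq> 0" if "x \<in> \<Omega>" for x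
      using hurwitz_det_cjac[OF locG \<Omega> limg locinjG z det0(1) that] .
    have deth: "det (cjac h y) \<noteq> 0" if "y \<in> ball 0 \<rho>" for y
      using hurwitz_det_cjac[OF locH open_ball connected_ball limh locinjH h0 det0(2) that] .
    have valG: "\<forall>\<^sub>F n in sequentially. g x \<in> G n ` ball x e" if "x \<in> \<Omega>" "e > 0" for x e
      using limit_value_in_image[OF locG \<Omega>(1) limg locinjG that(1) detg[OF that(1)] that(2)] .
    have valH: "\<forall>\<^sub>F n in sequentially. h y \<in> H n ` ball y e" if "y \<in> ball 0 \<rho>" "e > 0" for y e
      using limit_value_in_image[OF locH open_ball limh locinjH that(1) deth[OF that(1)] that(2)] .
    \<comment> \<open>\<open>h y\<close> is a value of some \<open>H n\<close> at a point of the
      ball, and \<open>H n\<close> maps into \<Omega> itself rather than its closure.\<close>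
    have "h y \<in> \<Omega>" if y: "y \<in> ball 0 \<rho>" for y
    proof -
      obtain R where R: "R > 0" "ball y R \<subseteq> ball 0 \<rho>"
        using y open_contains_ball by (metis open_ball)
      obtain n where "h y \<in> H n ` ball y R"
        using eventually_happens[OF valH[OF y R(1)]] by auto
      then show ?thesis
        using R(2) TV(2)[of n] im(2)[of n] by blast
    qed
    then have onto: "ball 0 \<rho> \<subseteq> g ` \<Omega>"
      using gh by (metis image_eqI subsetI)
    \<comment> \<open>Equal values of \<open>g\<close> at two points are taken by one and the same
      \<open>G n\<close> in disjoint balls around them, against the injectivity of
      \<open>G n\<close>.\<close>
    have injg: "inj_on g \<Omega>"
    proof (rule inj_onI, rule ccontr)
      fix x x' assume x: "x \<in> \<Omega>" "x' \<in> \<Omega>" "g x = g x'" "x \<noteq> x'"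
      obtain R where R: "R > 0" "\<forall>\<^sub>F n in sequentially. ball x R \<subseteq> T n"
        using cover[OF x(1)] by blast
      obtain R' where R': "R' > 0" "\<forall>\<^sub>F n in sequentially. ball x' R' \<subseteq> T n"
        using cover[OF x(2)] by blast
      define e where "e = min (dist x x' / 2) (min R R')"
      have e: "e > 0" "ball x e \<subseteq> ball x R" "ball x' e \<subseteq> ball x' R'"
        using x(4) R(1) R'(1) by (auto simp: e_def)
      have "\<forall>\<^sub>F n in sequentially. False"
        using R(2) R'(2) valG[OF x(1) e(1)] valG[OF x(2) e(1)]
      proof eventually_elim
        case (elim n)
        then obtain a b where ab: "a \<in> ball x e" "b \<in> ball x' e" "g x = G n a" "g x' = G n b"
          by blast
        then have "a \<in> T n" "b \<in> T n"
          using elim(1,2) e(2,3) by blast+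
        then have "a = b"
          using ab(3,4) x(3) inj_onD[OF injG[of n], of a b] by simp
        then have "dist x x' < e + e"
          using ab(1,2) dist_triangle_less_add[of x a e x' e] by (simp add: dist_commute)
        then show ?case by (simp add: e_def)
      qed
      then show False by simp
    qed
    \<comment> \<open>Limits of points of the open ball are only known to lie in the closed ball;
      openness of the image then excludes the sphere.\<close>
    have "g ` \<Omega> \<subseteq> cball 0 1"
    proof
      fix w assume "w \<in> g ` \<Omega>"
      then obtain x where x: "x \<in> \<Omega>" "w = g x" by blast
      have "\<forall>\<^sub>F n in sequentially. norm (G n x) \<le> 1"
        using mem_ev[OF x(1)]
      proof eventually_elim
        case (elim n)
        then have "G n x \<in> ball 0 1" using im(1) by blast
        then show ?case by simp
      qed
      then have "norm (g x) \<le> 1"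
        by (intro tendsto_upperbound[OF tendsto_norm[OF limg[OF x(1)]]]) auto
      then show "w \<in> cball 0 1" by (simp add: x(2))
    qed
    moreover have "open (g ` \<Omega>)"
      using invariance_of_domain[OF contg \<Omega>(1) injg] .
    ultimately have "g ` \<Omega> \<subseteq> ball 0 1"
      using interior_maximal[of "g ` \<Omega>" "cball 0 1"] by simp
    then have "inj_holomorphic_map g \<Omega> (ball 0 1)"
      using holg injg by (simp add: inj_holomorphic_map_def)
    then show ?thesis
      using squeezing_function_ge[OF _ \<Omega>(1) z gz \<rho>(1) onto] by blast
  qed
  then show ?thesis
    using assms(1,2) \<rho>(1) unfolding homogenous_regular_def by blast
qed

end
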